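(* Let $t\geq 3$ be a fixed integer and let $\mathcal{G}$ be the class of $\{K_{1,t},\text{diamond}\}$-free graphs. Then \textsc{Subgraph Complementation to} $\mathcal{G}$ can be solved in polynomial time: there is a polynomial-time algorithm that, given a graph $G$, decides whether there is a set $S\subseteq V(G)$ such that $G\oplus S\in\mathcal{G}$.
   Context: All graphs are finite and simple. For a graph $G$ and $S\subseteq V(G)$, $G\oplus S$ is the graph on $V(G)$ obtained by complementing the subgraph induced by $S$: $uv$ is an edge of $G\oplus S$ iff either $u,v\in S$ and $uv$ is a nonedge of $G$, or $uv$ is an edge of $G$ and $\{u,v\}\setminus S\neq\emptyset$. For a graph class $\mathcal{G}$, \textsc{Subgraph Complementation to} $\mathcal{G}$ asks, given $G$, whether some $S\subseteq V(G)$ has $G\oplus S\in\mathcal{G}$. $K_{1,t}$ is the star with one center of degree $t$ and $t$ leaves. The diamond is $K_4$ minus one edge. A graph is $\mathcal{H}$-free if it contains no induced subgraph isomorphic to a member of $\mathcal{H}$. *)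

theory Defs
  imports
    "HOL-Computational_Algebra.Polynomial"
    "HOL-Library.Discrete_Functions"
begin

section \<open>Finite simple graphs\<close>

record 'a graph =
  verts :: "'a set"
  edges :: "'a set set"

definition finite_simple_graph :: "'a graph \<Rightarrow> bool" where
  "finite_simple_graph G \<longleftrightarrow>
     finite (verts G) \<and> (\<forall>e\<in>edges G. e \<subseteq> verts G \<and> card e = 2)"

definition induced_subgraph :: "'a graph \<Rightarrow> 'a set \<Rightarrow> 'a graph" where
  "induced_subgraph G W = \<lparr>verts = W, edges = {e \<in> edges G. e \<subseteq> W}\<rparr>"

definition graph_isomorphic :: "'a graph \<Rightarrow> 'b graph \<Rightarrow> bool" where
  "graph_isomorphic G H \<longleftrightarrow>
     (\<exists>f. bij_betw f (verts G) (verts H) \<and>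
          (\<forall>u\<in>verts G. \<forall>v\<in>verts G. {u, v} \<in> edges G \<longleftrightarrow> {f u, f v} \<in> edges H))"

definition free_graphs :: "'b graph set \<Rightarrow> 'a graph set" where
  "free_graphs \<H> =
     {G. finite_simple_graph G \<and>
         \<not> (\<exists>H\<in>\<H>. \<exists>W\<subseteq>verts G. graph_isomorphic (induced_subgraph G W) H)}"

definition star :: "nat \<Rightarrow> nat graph" where
  "star t = \<lparr>verts = {0..t}, edges = {{0, i} | i. i \<in> {1..t}}\<rparr>"

definition diamond :: "nat graph" where
  "diamond = \<lparr>verts = {0..3}, edges = {e. e \<subseteq> {0..3} \<and> card e = 2} - {{2, 3}}\<rparr>"

definition subgraph_complement :: "'a graph \<Rightarrow> 'a set \<Rightarrow> 'a graph" where
  "subgraph_complement G S =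
     \<lparr>verts = verts G,
      edges = {{u, v} | u v. u \<in> verts G \<and> v \<in> verts G \<and> u \<noteq> v \<and>
                 ((u \<in> S \<and> v \<in> S \<and> {u, v} \<notin> edges G) \<or>
                  ({u, v} \<in> edges G \<and> {u, v} - S \<noteq> {}))}\<rparr>"

definition subgraph_complementation_to :: "'a graph set \<Rightarrow> 'a graph set" where
  "subgraph_complementation_to \<G> =
     {G. finite_simple_graph G \<and> (\<exists>S\<subseteq>verts G. subgraph_complement G S \<in> \<G>)}"

lemma finite_simple_graph_subgraph_complement:
  "finite_simple_graph G \<Longrightarrow> finite_simple_graph (subgraph_complement G S)"
  by (auto simp: finite_simple_graph_def subgraph_complement_def)


section \<open>Random access machines\<close>

text \<open>
  The machine model is a deterministic random access machine over the natural numbers, with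
  addition and truncated subtraction as its only arithmetic and with the logarithmic cost
  measure: an instruction costs the total number of bits of the numbers (values and memory
  addresses) that it handles. Polynomial time on this machine is polynomial time on Turing
  machines. A configuration consists of the program counter, the registers, which instructions
  name directly, and the memory, which is only accessible through addresses held in registers.
  The machine halts as soon as the program counter points outside the program.
\<close>

datatype instr =
    Const nat nat     \<comment> \<open>\<open>Const r c\<close>: \<open>R[r] := c\<close>\<close>
  | Add nat nat nat   \<comment> \<open>\<open>Add r a b\<close>: \<open>R[r] := R[a] + R[b]\<close>\<close>
  | Sub nat nat nat   \<comment> \<open>\<open>Sub r a b\<close>: \<open>R[r] := R[a] - R[b]\<close>\<close>
  | Load nat nat      \<comment> \<open>\<open>Load r a\<close>: \<open>R[r] := M[R[a]]\<close>\<close>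
  | Store nat nat     \<comment> \<open>\<open>Store a r\<close>: \<open>M[R[a]] := R[r]\<close>\<close>
  | JumpZero nat nat  \<comment> \<open>\<open>JumpZero r l\<close>: continue at instruction \<open>l\<close> if \<open>R[r] = 0\<close>\<close>

type_synonym program = "instr list"

type_synonym config = "nat \<times> (nat \<Rightarrow> nat) \<times> (nat \<Rightarrow> nat)"

fun exec :: "instr \<Rightarrow> config \<Rightarrow> config" where
  "exec (Const r c) (pc, R, M) = (Suc pc, R(r := c), M)"
| "exec (Add r a b) (pc, R, M) = (Suc pc, R(r := R a + R b), M)"
| "exec (Sub r a b) (pc, R, M) = (Suc pc, R(r := R a - R b), M)"
| "exec (Load r a) (pc, R, M) = (Suc pc, R(r := M (R a)), M)"
| "exec (Store a r) (pc, R, M) = (Suc pc, R, M(R a := R r))"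
| "exec (JumpZero r l) (pc, R, M) = (if R r = 0 then l else Suc pc, R, M)"

text \<open>The number of binary digits, where 0 counts as one digit.\<close>

definition bit_length :: "nat \<Rightarrow> nat" where
  "bit_length n = Suc (floor_log n)"

fun cost :: "instr \<Rightarrow> config \<Rightarrow> nat" where
  "cost (Const r c) (pc, R, M) = bit_length c"
| "cost (Add r a b) (pc, R, M) = bit_length (R a) + bit_length (R b)"
| "cost (Sub r a b) (pc, R, M) = bit_length (R a) + bit_length (R b)"
| "cost (Load r a) (pc, R, M) = bit_length (R a) + bit_length (M (R a))"
| "cost (Store a r) (pc, R, M) = bit_length (R a) + bit_length (R r)"
| "cost (JumpZero r l) (pc, R, M) = bit_length (R r)"

text \<open>\<open>runs P c k c'\<close>: program \<open>P\<close> gets from configuration \<open>c\<close> to \<open>c'\<close> at total cost \<open>k\<close>.\<close>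

inductive runs :: "program \<Rightarrow> config \<Rightarrow> nat \<Rightarrow> config \<Rightarrow> bool" for P where
  refl: "runs P c 0 c"
| step: "fst c < length P \<Longrightarrow> runs P (exec (P ! fst c) c) k c' \<Longrightarrow>
           runs P c (cost (P ! fst c) c + k) c'"

text \<open>
  The input string is stored in the memory cells from 0 on, its length in register 0;
  everything else is 0. The answer is left in register 0: 1 for yes, 0 for no.
\<close>

definition initial_config :: "bool list \<Rightarrow> config" where
  "initial_config w =
     (0, (\<lambda>_. 0)(0 := length w), \<lambda>i. if i < length w then of_bool (w ! i) else 0)"

definition answers :: "program \<Rightarrow> bool list \<Rightarrow> nat \<Rightarrow> bool \<Rightarrow> bool" where
  "answers P w k b \<longleftrightarrow>
     (\<exists>pc R M. runs P (initial_config w) k (pc, R, M) \<and> length P \<le> pc \<and> R 0 = of_bool b)"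

text \<open>
  \<open>enc x\<close> is the set of strings that represent the instance \<open>x\<close>, \<open>I\<close> the set of all instances
  and \<open>Y\<close> the set of yes-instances. The algorithm has to be correct on every representation
  of every instance.
\<close>

definition polynomial_time_solvable ::
    "('i \<Rightarrow> bool list set) \<Rightarrow> 'i set \<Rightarrow> 'i set \<Rightarrow> bool" where
  "polynomial_time_solvable enc I Y \<longleftrightarrow>
     (\<exists>(P :: program) (p :: nat poly). \<forall>x\<in>I. \<forall>w\<in>enc x.
        \<exists>k \<le> poly p (length w). answers P w k (x \<in> Y))"


section \<open>Graphs as inputs\<close>

text \<open>
  A graph is given by its adjacency matrix, row by row, with respect to an arbitrary
  enumeration of its vertices.
\<close>

definition adjacency_matrix :: "'a graph \<Rightarrow> 'a list \<Rightarrow> bool list" where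
  "adjacency_matrix G vs = concat (map (\<lambda>u. map (\<lambda>v. {u, v} \<in> edges G) vs) vs)"

definition graph_encodings :: "'a graph \<Rightarrow> bool list set" where
  "graph_encodings G = {adjacency_matrix G vs | vs. distinct vs \<and> set vs = verts G}"

end

theory Submission
  imports Defs
begin

text \<open>
  Let \<open>G' = G \<oplus> S\<close> be \<open>{K\<^sub>1\<^sub>,\<^sub>t, diamond}\<close>-free. In \<open>G'\<close> every neighbourhood is a disjoint union of fewer
  than \<open>t\<close> cliques. Pick a vertex \<open>x\<close> together with up to two vertices outside \<open>S\<close> from each clique of its
  neighbourhood. If \<open>v \<notin> S\<close> is a neighbour of \<open>x\<close> and these vertices do not distinguish \<open>u \<in> S\<close> from \<open>v\<close>
  in \<open>G\<close>, then \<open>u\<close> lies in the maximal clique containing \<open>x\<close> and \<open>v\<close>. Hence, if \<open>S\<close> contains two vertices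
  nonadjacent in \<open>G'\<close>, or is a clique of \<open>G'\<close> that is not maximal, a set \<open>P\<close> of at most \<open>5t + 2\<close> vertices
  distinguishes every vertex of \<open>S\<close> from every vertex outside \<open>S\<close>; and if \<open>S\<close> is a maximal clique of \<open>G'\<close>,
  then \<open>G\<close> itself is \<open>{K\<^sub>1\<^sub>,\<^sub>t, diamond}\<close>-free. So a solution exists iff one exists that is a union of
  atomic types over \<open>5t + 2\<close> vertices. This is a first-order property of \<open>G\<close>, and a fixed first-order
  formula is evaluated in polynomial time by nested loops over the vertices.
\<close>

section \<open>Separating a solution by few vertices\<close>

lemma finite_simple_graph_edgeD:
  assumes "finite_simple_graph G" "{u, v} \<in> edges G"
  shows "u \<in> verts G" "v \<in> verts G" "u \<noteq> v"
  using assms unfolding finite_simple_graph_def by fastforce+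

text \<open>An induced copy of \<open>H\<close> as a map on its vertices rather than a vertex subset
  of \<open>G\<close>: a map on \<open>k\<close> vertices turns into \<open>k\<close> first-order
  quantifiers.\<close>

definition embeds :: "'b graph \<Rightarrow> 'a graph \<Rightarrow> ('b \<Rightarrow> 'a) \<Rightarrow> bool" where
  "embeds H G f \<longleftrightarrow> f ` verts H \<subseteq> verts G \<and> inj_on f (verts H) \<and>
     (\<forall>i\<in>verts H. \<forall>j\<in>verts H. {f i, f j} \<in> edges G \<longleftrightarrow> {i, j} \<in> edges H)"

lemma induced_isomorphic_iff_embeds:
  "(\<exists>W\<subseteq>verts G. graph_isomorphic (induced_subgraph G W) H) \<longleftrightarrow> (\<exists>f. embeds H G f)"
proof
  assume "\<exists>W\<subseteq>verts G. graph_isomorphic (induced_subgraph G W) H"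
  then obtain W g where W: "W \<subseteq> verts G" and g: "bij_betw g W (verts H)"
    and e: "\<forall>u\<in>W. \<forall>v\<in>W. {u, v} \<in> edges G \<longleftrightarrow> {g u, g v} \<in> edges H"
    by (auto simp: graph_isomorphic_def induced_subgraph_def)
  define f where "f = inv_into W g"
  have f: "bij_betw f (verts H) W"
    unfolding f_def by (rule bij_betw_inv_into[OF g])
  have gf: "g (f i) = i" if "i \<in> verts H" for i
    using that g unfolding f_def by (meson bij_betw_inv_into_right)
  have fW: "f i \<in> W" if "i \<in> verts H" for i
    using that f by (meson bij_betwE)
  have "embeds H G f"
    unfolding embeds_def using f W e gf fW by (auto simp: bij_betw_def)
  then show "\<exists>f. embeds H G f"
    by blast
next
  assume "\<exists>f. embeds H G f"
  then obtain f where f: "f ` verts H \<subseteq> verts G" "inj_on f (verts H)"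
    and e: "\<forall>i\<in>verts H. \<forall>j\<in>verts H. {f i, f j} \<in> edges G \<longleftrightarrow> {i, j} \<in> edges H"
    unfolding embeds_def by blast
  have "bij_betw (inv_into (verts H) f) (f ` verts H) (verts H)"
    using f(2) by (simp add: bij_betw_inv_into inj_on_imp_bij_betw)
  then have "graph_isomorphic (induced_subgraph G (f ` verts H)) H"
    unfolding graph_isomorphic_def induced_subgraph_def
    using e f(2) by (intro exI[of _ "inv_into (verts H) f"]) auto
  then show "\<exists>W\<subseteq>verts G. graph_isomorphic (induced_subgraph G W) H"
    using f(1) by blast
qed

lemma in_free_graphs_iff:
  "G \<in> free_graphs \<H> \<longleftrightarrow> finite_simple_graph G \<and> (\<forall>H\<in>\<H>. \<not> (\<exists>f. embeds H G f))"
  by (simp add: free_graphs_def induced_isomorphic_iff_embeds)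

lemma edge_subgraph_complement_iff:
  assumes "finite_simple_graph G" "u \<in> verts G" "v \<in> verts G"
  shows "{u, v} \<in> edges (subgraph_complement G S) \<longleftrightarrow>
    u \<noteq> v \<and> ({u, v} \<in> edges G \<longleftrightarrow> \<not> (u \<in> S \<and> v \<in> S))"
  using assms(2,3) finite_simple_graph_edgeD[OF assms(1)]
  by (auto simp: subgraph_complement_def doubleton_eq_iff insert_commute)

text \<open>A closure rule for adjacency, the form used in all later arguments. In a loopless graph
  the adjacencies force all pairs other than \<open>c\<close>, \<open>d\<close> to be
  distinct.\<close>

definition diamond_free_adj :: "('a \<Rightarrow> 'a \<Rightarrow> bool) \<Rightarrow> bool" where
  "diamond_free_adj E \<longleftrightarrow>
     (\<forall>a b c d. E a b \<longrightarrow> E a c \<longrightarrow> E a d \<longrightarrow> E b c \<longrightarrow> E b d \<longrightarrow> c \<noteq> d \<longrightarrow> E c d)"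

definition star_free_adj :: "nat \<Rightarrow> ('a \<Rightarrow> 'a \<Rightarrow> bool) \<Rightarrow> bool" where
  "star_free_adj t E \<longleftrightarrow>
     (\<nexists>x I. card I = t \<and> (\<forall>i\<in>I. E x i) \<and> (\<forall>i\<in>I. \<forall>j\<in>I. \<not> E i j))"

lemma diamond_free_iff:
  assumes G: "finite_simple_graph G"
  shows "(\<exists>f. embeds diamond G f) \<longleftrightarrow> \<not> diamond_free_adj (\<lambda>u v. {u, v} \<in> edges G)"
proof
  have v: "verts diamond = {0, 1, 2, 3}"
    by (auto simp: diamond_def)
  have e: "{i, j} \<in> edges diamond \<longleftrightarrow> i \<noteq> j \<and> {i, j} \<noteq> {2, 3}"
    if "i \<in> {0, 1, 2, 3}" "j \<in> {0, 1, 2, 3}" for i j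
    using that unfolding diamond_def by (cases "i = j") (simp_all add: doubleton_eq_iff, auto)
  {
    assume "\<exists>f. embeds diamond G f"
    then obtain f where f: "embeds diamond G f"
      by blast
    then have inj: "inj_on f {0, 1, 2, 3}"
      by (simp add: embeds_def v)
    have f: "{f i, f j} \<in> edges G \<longleftrightarrow> {i, j} \<in> edges diamond"
      if "i \<in> verts diamond" "j \<in> verts diamond" for i j
      using f that unfolding embeds_def by blast
    have "f 2 \<noteq> f 3"
      using inj_onD[OF inj, of 2 3] by auto
    moreover have "{f 0, f 1} \<in> edges G" "{f 0, f 2} \<in> edges G" "{f 0, f 3} \<in> edges G"
      "{f 1, f 2} \<in> edges G" "{f 1, f 3} \<in> edges G" "{f 2, f 3} \<notin> edges G"
      using f[of 0 1] f[of 0 2] f[of 0 3] f[of 1 2] f[of 1 3] f[of 2 3]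
      by (simp_all add: e v doubleton_eq_iff)
    ultimately show "\<not> diamond_free_adj (\<lambda>u v. {u, v} \<in> edges G)"
      unfolding diamond_free_adj_def by blast
  }
  assume "\<not> diamond_free_adj (\<lambda>u v. {u, v} \<in> edges G)"
  then obtain a b c d where E: "{a, b} \<in> edges G" "{a, c} \<in> edges G" "{a, d} \<in> edges G"
    "{b, c} \<in> edges G" "{b, d} \<in> edges G" "c \<noteq> d" "{c, d} \<notin> edges G"
    unfolding diamond_free_adj_def by blast
  note ne = finite_simple_graph_edgeD[OF G E(1)] finite_simple_graph_edgeD[OF G E(2)]
    finite_simple_graph_edgeD[OF G E(3)] finite_simple_graph_edgeD[OF G E(4)]
    finite_simple_graph_edgeD[OF G E(5)]
  have loop: "{x} \<notin> edges G" for x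
    using finite_simple_graph_edgeD(3)[OF G, of x x] by auto
  have E': "{b, a} \<in> edges G" "{c, a} \<in> edges G" "{d, a} \<in> edges G"
    "{c, b} \<in> edges G" "{d, b} \<in> edges G" "{d, c} \<notin> edges G"
    using E by (simp_all add: insert_commute)
  define f where "f = (\<lambda>_. a)(1 :: nat := b, 2 := c, 3 := d)"
  have fs: "f 0 = a" "f 1 = b" "f 2 = c" "f 3 = d" "f (Suc 0) = b"
    by (auto simp: f_def)
  have "{f i, f j} \<in> edges G \<longleftrightarrow> {i, j} \<in> edges diamond"
    if "i \<in> {0, 1, 2, 3}" "j \<in> {0, 1, 2, 3}" for i j
    unfolding e[OF that] using that E E'
    by (elim insertE emptyE; hypsubst) (simp_all only: fs, simp_all add: loop doubleton_eq_iff)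
  moreover have "inj_on f {0, 1, 2, 3}"
    using E(6) ne by (simp add: fs)
  moreover have "f ` {0, 1, 2, 3} \<subseteq> verts G"
    using ne by (simp add: fs)
  ultimately have "embeds diamond G f"
    unfolding embeds_def v by blast
  then show "\<exists>f. embeds diamond G f"
    by blast
qed

lemma star_free_iff:
  assumes G: "finite_simple_graph G" and t: "t \<ge> 1"
  shows "(\<exists>f. embeds (star t) G f) \<longleftrightarrow> \<not> star_free_adj t (\<lambda>u v. {u, v} \<in> edges G)"
proof
  have e: "{i, j} \<in> edges (star t) \<longleftrightarrow> (i = 0 \<and> j \<in> {1..t} \<or> j = 0 \<and> i \<in> {1..t})" for i j
    by (auto simp: star_def doubleton_eq_iff)
  have v: "verts (star t) = {0..t}"
    by (simp add: star_def)
  {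
    assume "\<exists>f. embeds (star t) G f"
    then obtain f where inj: "inj_on f {0..t}"
      and f: "\<And>i j. i \<le> t \<Longrightarrow> j \<le> t \<Longrightarrow>
        {f i, f j} \<in> edges G \<longleftrightarrow> (i = 0 \<and> j \<in> {1..t} \<or> j = 0 \<and> i \<in> {1..t})"
      unfolding embeds_def v e by auto
    have "card (f ` {1..t}) = t"
      using inj by (subst card_image) (auto intro: inj_on_subset)
    moreover have "\<forall>i\<in>f ` {1..t}. {f 0, i} \<in> edges G"
      using f by auto
    moreover have "\<forall>i\<in>f ` {1..t}. \<forall>j\<in>f ` {1..t}. {i, j} \<notin> edges G"
      using f by auto
    ultimately show "\<not> star_free_adj t (\<lambda>u v. {u, v} \<in> edges G)"
      unfolding star_free_adj_def by blast
  }
  assume "\<not> star_free_adj t (\<lambda>u v. {u, v} \<in> edges G)"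
  then obtain x I where I: "card I = t" "\<And>i. i \<in> I \<Longrightarrow> {x, i} \<in> edges G"
    "\<And>i j. i \<in> I \<Longrightarrow> j \<in> I \<Longrightarrow> {i, j} \<notin> edges G"
    unfolding star_free_adj_def by blast
  have "finite I"
    using I(1) t by (metis card.infinite not_one_le_zero)
  then obtain g where g: "bij_betw g {1..t} I"
    using I(1) by (metis ex_bij_betw_nat_finite_1)
  define f where "f = g(0 := x)"
  have fI: "f i \<in> I" if "i \<in> {1..t}" for i
    using that g by (auto simp: f_def bij_betw_def)
  have f0: "f 0 = x"
    by (simp add: f_def)
  have IV: "i \<in> verts G \<and> i \<noteq> x" if "i \<in> I" for i
    using finite_simple_graph_edgeD[OF G I(2)[OF that]] by auto
  have xV: "x \<in> verts G"
  proof -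
    have "f 1 \<in> I"
      using fI t by simp
    then show ?thesis
      using finite_simple_graph_edgeD[OF G I(2)] by blast
  qed
  have split: "{0..t} = insert 0 {1..t}"
    by auto
  have "inj_on f {1..t} \<longleftrightarrow> inj_on g {1..t}"
    by (rule inj_on_cong) (simp add: f_def)
  then have "inj_on f {1..t}"
    using g by (simp add: bij_betw_def)
  moreover have "f 0 \<notin> f ` {1..t}"
    using fI IV f0 by force
  ultimately have "inj_on f {0..t}"
    unfolding split by simp
  moreover have "f ` {0..t} \<subseteq> verts G"
    unfolding split using fI IV f0 xV by auto
  moreover have "{f i, f j} \<in> edges G \<longleftrightarrow> (i = 0 \<and> j \<in> {1..t} \<or> j = 0 \<and> i \<in> {1..t})"
    if "i \<in> {0..t}" "j \<in> {0..t}" for i j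
  proof -
    have "{x} \<notin> edges G"
      using finite_simple_graph_edgeD(3)[OF G, of x x] by auto
    moreover have "{f i, x} \<in> edges G" if "i \<in> {1..t}" for i
      using I(2)[OF fI[OF that]] by (simp add: insert_commute)
    ultimately show ?thesis
      using that I(2,3) fI f0 unfolding split by auto
  qed
  ultimately have "embeds (star t) G f"
    unfolding embeds_def v e by blast
  then show "\<exists>f. embeds (star t) G f"
    by blast
qed

lemma in_free_star_diamond_iff:
  assumes "finite_simple_graph G" "t \<ge> 1"
  shows "G \<in> free_graphs {star t, diamond} \<longleftrightarrow>
    star_free_adj t (\<lambda>u v. {u, v} \<in> edges G) \<and> diamond_free_adj (\<lambda>u v. {u, v} \<in> edges G)"
  using assms(1) diamond_free_iff[OF assms(1)] star_free_iff[OF assms]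
  unfolding in_free_graphs_iff by blast

section \<open>Few vertices separating \<open>S\<close> from its complement\<close>

lemma star_free_card_le:
  assumes "star_free_adj t E" "finite I" "\<And>i. i \<in> I \<Longrightarrow> E x i"
    "\<And>i j. i \<in> I \<Longrightarrow> j \<in> I \<Longrightarrow> \<not> E i j"
  shows "card I \<le> t"
proof (rule ccontr)
  assume "\<not> card I \<le> t"
  then obtain J where "J \<subseteq> I" "card J = t"
    by (meson nat_le_linear obtain_subset_with_card_n)
  then show False
    using assms unfolding star_free_adj_def by blast
qed

text \<open>Models the graph \<open>G \<oplus> S\<close> by its adjacency relation \<open>E\<close>;
  the edges of \<open>G\<close> itself return explicitly in
  \<open>ex_separated_solution\<close>.\<close>

locale star_diamond_free =
  fixes V :: "'a set" and E :: "'a \<Rightarrow> 'a \<Rightarrow> bool" and t :: nat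
  assumes fin: "finite V"
    and EV: "E u v \<Longrightarrow> v \<in> V"
    and sym: "E u v \<Longrightarrow> E v u"
    and irrefl: "\<not> E u u"
    and sfree: "star_free_adj t E"
    and dfree: "diamond_free_adj E"
begin

lemma diamondD:
  "E a b \<Longrightarrow> E a c \<Longrightarrow> E a d \<Longrightarrow> E b c \<Longrightarrow> E b d \<Longrightarrow> c \<noteq> d \<Longrightarrow> E c d"
  using dfree unfolding diamond_free_adj_def by blast

text \<open>
  The neighbourhood of \<open>x\<close> is a disjoint union of at most \<open>t\<close> cliques; \<open>D\<close> consists of up to two
  vertices of \<open>X\<close> from each of them.
\<close>

lemma ex_two_per_clique:
  assumes "X \<subseteq> V"
  obtains D where "D \<subseteq> X" "card D \<le> 2 * t"
    "\<And>v. v \<in> X \<Longrightarrow> E x v \<Longrightarrow> v \<notin> D \<Longrightarrow>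
       \<exists>c\<in>D. \<exists>c'\<in>D. E c c' \<and> E v c \<and> E v c' \<and> E x c \<and> E x c'"
proof -
  \<comment> \<open>A maximal independent set among the neighbours of \<open>x\<close> in
    \<open>X\<close> contains one vertex of each clique that these neighbours form.\<close>
  define indep where "indep I \<longleftrightarrow> I \<subseteq> {v \<in> X. E x v} \<and> (\<forall>i\<in>I. \<forall>j\<in>I. \<not> E i j)" for I
  have fX: "finite X"
    using assms fin finite_subset by blast
  have "finite {I. indep I}"
    by (rule finite_subset[of _ "Pow X"]) (auto simp: indep_def fX)
  moreover have "indep {}"
    by (simp add: indep_def)
  ultimately obtain I where I: "indep I" and max: "\<And>J. indep J \<Longrightarrow> I \<subseteq> J \<Longrightarrow> J = I"
    using finite_has_maximal[of "{I. indep I}"] by blast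
  have fI: "finite I"
    using I fX unfolding indep_def by (auto intro: finite_subset)
  have cI: "card I \<le> t"
    using star_free_card_le[OF sfree fI, of x] I unfolding indep_def by blast
  \<comment> \<open>A second vertex of the clique of \<open>i\<close>, or \<open>i\<close> itself if
    that clique is a single vertex.\<close>
  define g where "g i = (if \<exists>c\<in>X. E x c \<and> E i c then SOME c. c \<in> X \<and> E x c \<and> E i c else i)" for i
  have g: "g i \<in> X \<and> E x (g i) \<and> E i (g i)" if "\<exists>c\<in>X. E x c \<and> E i c" for i
  proof -
    have "\<exists>c. c \<in> X \<and> E x c \<and> E i c"
      using that by blast
    from someI_ex[OF this] show ?thesis
      using that by (simp add: g_def)
  qed
  show ?thesis
  proof
    show "I \<union> g ` I \<subseteq> X"
    proof -
      have "g i \<in> X" if "i \<in> I" for i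
        using g[of i] that I unfolding indep_def g_def by fastforce
      then show ?thesis
        using I unfolding indep_def by blast
    qed
    have "card (I \<union> g ` I) \<le> card I + card (g ` I)"
      by (rule card_Un_le)
    then show "card (I \<union> g ` I) \<le> 2 * t"
      using cI card_image_le[OF fI, of g] by linarith
  next
    fix v assume v: "v \<in> X" "E x v" "v \<notin> I \<union> g ` I"
    have "\<exists>i\<in>I. E i v"
    proof (rule ccontr)
      assume n: "\<not> (\<exists>i\<in>I. E i v)"
      then have "indep (insert v I)"
        using I v irrefl sym unfolding indep_def by blast
      then show False
        using max[of "insert v I"] v(3) by blast
    qed
    then obtain i where i: "i \<in> I" "E i v"
      by blast
    have gi: "g i \<in> X" "E x (g i)" "E i (g i)"
      using g[of i] i v by blast+
    have xi: "E x i"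
      using I i(1) unfolding indep_def by blast
    have "v \<noteq> g i"
      using v(3) i(1) by blast
    then have "E v (g i)"
      using diamondD[of x i v "g i"] xi v(2) gi i(2) by blast
    then show "\<exists>c\<in>I \<union> g ` I. \<exists>c'\<in>I \<union> g ` I. E c c' \<and> E v c \<and> E v c' \<and> E x c \<and> E x c'"
      using i gi xi sym by blast
  qed
qed

text \<open>
  \<open>E\<close> is the adjacency relation of \<open>G \<oplus> S\<close>, whereas the vertices of \<open>P\<close> have to tell \<open>u\<close> from \<open>v\<close>
  in \<open>G\<close>; passing between the two flips the adjacency of \<open>u\<close> and \<open>p\<close> iff \<open>p \<in> S\<close>.
\<close>

definition separates :: "'a set \<Rightarrow> 'a set \<Rightarrow> bool" where
  "separates P S \<longleftrightarrow>
     (\<forall>u\<in>S - P. \<forall>v\<in>V - S - P. \<exists>p\<in>P. (p \<in> S \<longrightarrow> E u p = E v p) \<and> (p \<notin> S \<longrightarrow> E u p \<noteq> E v p))"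

lemma not_separatesE:
  assumes "\<not> separates P S"
  obtains u v where "u \<in> S" "u \<notin> P" "v \<in> V" "v \<notin> S" "v \<notin> P"
    "\<forall>p\<in>P. p \<in> S \<longrightarrow> E u p \<noteq> E v p"
    "\<forall>p\<in>P. p \<notin> S \<longrightarrow> E u p = E v p"
  using assms unfolding separates_def by blast

text \<open>\<open>P\<close> is \<open>x\<close> with up to two vertices outside \<open>S\<close>
  from each clique of its neighbourhood. The clique of \<open>v\<close> provides adjacent
  \<open>c\<close>, \<open>c'\<close> in \<open>P\<close>; \<open>u\<close> agrees with
  \<open>v\<close> there, so \<open>u\<close> is a common neighbour of \<open>c\<close>,
  \<open>c'\<close>, as \<open>x\<close> and \<open>v\<close> are. Diamond-freeness at the edge
  \<open>c c'\<close> yields both adjacencies.\<close>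

lemma ex_forcing_set:
  assumes "x \<in> V"
  obtains P where "P \<subseteq> V" "card P \<le> 2 * t + 1" "x \<in> P"
    "\<And>u v. \<lbrakk>u \<in> S; u \<notin> P; v \<in> V; v \<notin> S; v \<notin> P;
       \<And>p. p \<in> P \<Longrightarrow> p \<notin> S \<Longrightarrow> E u p = E v p; E x v\<rbrakk> \<Longrightarrow> E u x \<and> E u v"
proof -
  obtain D where D: "D \<subseteq> V - S" "card D \<le> 2 * t"
    "\<And>v. v \<in> V - S \<Longrightarrow> E x v \<Longrightarrow> v \<notin> D \<Longrightarrow>
       \<exists>c\<in>D. \<exists>c'\<in>D. E c c' \<and> E v c \<and> E v c' \<and> E x c \<and> E x c'"
    using ex_two_per_clique[of "V - S" x] by blast
  show ?thesis
  proof
    show "insert x D \<subseteq> V" "x \<in> insert x D"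
      using D assms by auto
    have "card (insert x D) \<le> Suc (card D)"
      by (rule card_insert_le_m1) auto
    then show "card (insert x D) \<le> 2 * t + 1"
      using D(2) by linarith
  next
    fix u v
    assume u: "u \<in> S" "u \<notin> insert x D" and v: "v \<in> V" "v \<notin> S" "v \<notin> insert x D"
      and eq: "\<And>p. p \<in> insert x D \<Longrightarrow> p \<notin> S \<Longrightarrow> E u p = E v p" and xv: "E x v"
    obtain c c' where c: "c \<in> D" "c' \<in> D" "E c c'" "E v c" "E v c'" "E x c" "E x c'"
      using D(3)[of v] v xv by blast
    have uc: "E u c" "E u c'"
      using eq[of c] eq[of c'] c D(1) by auto
    have "E u x"
      using diamondD[of c c' u x] uc c u(2) sym by blast
    moreover have "E u v"
      using diamondD[of c c' u v] uc c u(1) v(2) sym by blast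
    ultimately show "E u x \<and> E u v" ..
  qed
qed

text \<open>Suppose \<open>u\<close> is not separated from \<open>v\<close>. Exactly one of them is
  adjacent to \<open>x\<close>, as \<open>x \<in> S\<close>, and adjacency of \<open>v\<close> would
  force that of \<open>u\<close>; so \<open>u\<close> is adjacent to \<open>x\<close> and likewise
  to \<open>y\<close>. But the common neighbours of \<open>x\<close> and \<open>y\<close> belong to
  the separating set. Its size is at most \<open>2 * (2 * t + 1) + t\<close>.\<close>

lemma ex_separating_set_if_not_clique:
  assumes "x \<in> S" "y \<in> S" "S \<subseteq> V" "x \<noteq> y" "\<not> E x y"
  shows "\<exists>P\<subseteq>V. card P \<le> 5 * t + 2 \<and> separates P S"
proof -
  have xy: "x \<in> V" "y \<in> V"
    using assms by auto
  obtain P where P: "P \<subseteq> V" "card P \<le> 2 * t + 1" "x \<in> P"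
    "\<And>u v. \<lbrakk>u \<in> S; u \<notin> P; v \<in> V; v \<notin> S; v \<notin> P;
       \<And>p. p \<in> P \<Longrightarrow> p \<notin> S \<Longrightarrow> E u p = E v p; E x v\<rbrakk> \<Longrightarrow> E u x \<and> E u v"
    using ex_forcing_set[OF xy(1), of S] by metis
  obtain Q where Q: "Q \<subseteq> V" "card Q \<le> 2 * t + 1" "y \<in> Q"
    "\<And>u v. \<lbrakk>u \<in> S; u \<notin> Q; v \<in> V; v \<notin> S; v \<notin> Q;
       \<And>p. p \<in> Q \<Longrightarrow> p \<notin> S \<Longrightarrow> E u p = E v p; E y v\<rbrakk> \<Longrightarrow> E u y \<and> E u v"
    using ex_forcing_set[OF xy(2), of S] by metis
  define Z where "Z = {z. E x z \<and> E y z}"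
  have ZV: "Z \<subseteq> V"
    unfolding Z_def using EV by blast
  have fZ: "finite Z"
    using ZV fin finite_subset by blast
  \<comment> \<open>An edge within \<open>Z\<close> would form a diamond with the nonadjacent
    \<open>x\<close> and \<open>y\<close>; hence \<open>Z\<close> is an independent part of the
    neighbourhood of \<open>x\<close>.\<close>
  have "\<not> E i j" if "i \<in> Z" "j \<in> Z" for i j
    using diamondD[of i j x y] that assms sym unfolding Z_def by blast
  then have cZ: "card Z \<le> t"
    using star_free_card_le[OF sfree fZ, of x] unfolding Z_def by blast
  have "card (P \<union> Q \<union> Z) \<le> card P + card Q + card Z"
    using card_Un_le[of P Q] card_Un_le[of "P \<union> Q" Z] by linarith
  then have "card (P \<union> Q \<union> Z) \<le> 5 * t + 2"
    using P(2) Q(2) cZ by linarith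
  moreover have "separates (P \<union> Q \<union> Z) S"
  proof (rule ccontr)
    assume "\<not> separates (P \<union> Q \<union> Z) S"
    then obtain u v where uv: "u \<in> S" "u \<notin> P \<union> Q \<union> Z" "v \<in> V" "v \<notin> S" "v \<notin> P \<union> Q \<union> Z"
      and in_S: "\<forall>p\<in>P \<union> Q \<union> Z. p \<in> S \<longrightarrow> E u p \<noteq> E v p"
      and out_S: "\<forall>p\<in>P \<union> Q \<union> Z. p \<notin> S \<longrightarrow> E u p = E v p"
      by (rule not_separatesE)
    have "E u x"
      using P(4)[of u v] in_S uv out_S P(3) assms(1) sym by blast
    moreover have "E u y"
      using Q(4)[of u v] in_S uv out_S Q(3) assms(2) sym by blast
    ultimately show False
      using uv(2) sym unfolding Z_def by blast
  qed
  ultimately show ?thesis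
    using P(1) Q(1) ZV by (intro exI[of _ "P \<union> Q \<union> Z"]) auto
qed

text \<open>Here \<open>b\<close> shows that the clique \<open>S\<close> is not maximal. If
  \<open>v\<close> is not separated from \<open>u\<close>, then \<open>v\<close> is not adjacent to
  \<open>x \<in> S\<close>, since \<open>u\<close> is, but adjacent to \<open>b \<notin> S\<close>,
  since \<open>u\<close> is. The forcing set of \<open>b\<close> makes \<open>u\<close> and
  \<open>v\<close> adjacent, and the edge \<open>u b\<close> with common neighbours
  \<open>v\<close>, \<open>x\<close> then contradicts diamond-freeness.\<close>

lemma ex_separating_set_if_clique_extends:
  assumes S: "S \<subseteq> V" "\<And>u v. u \<in> S \<Longrightarrow> v \<in> S \<Longrightarrow> u \<noteq> v \<Longrightarrow> E u v"
    and b: "b \<in> V" "b \<notin> S" "\<And>u. u \<in> S \<Longrightarrow> E u b" and x: "x \<in> S"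
  shows "\<exists>P\<subseteq>V. card P \<le> 5 * t + 2 \<and> separates P S"
proof -
  have xV: "x \<in> V"
    using S x by auto
  obtain P where P: "P \<subseteq> V" "card P \<le> 2 * t + 1" "x \<in> P"
    "\<And>u v. \<lbrakk>u \<in> S; u \<notin> P; v \<in> V; v \<notin> S; v \<notin> P;
       \<And>p. p \<in> P \<Longrightarrow> p \<notin> S \<Longrightarrow> E u p = E v p; E x v\<rbrakk> \<Longrightarrow> E u x \<and> E u v"
    using ex_forcing_set[OF xV, of S] by metis
  obtain Q where Q: "Q \<subseteq> V" "card Q \<le> 2 * t + 1" "b \<in> Q"
    "\<And>u v. \<lbrakk>u \<in> S; u \<notin> Q; v \<in> V; v \<notin> S; v \<notin> Q;
       \<And>p. p \<in> Q \<Longrightarrow> p \<notin> S \<Longrightarrow> E u p = E v p; E b v\<rbrakk> \<Longrightarrow> E u b \<and> E u v"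
    using ex_forcing_set[OF b(1), of S] by metis
  have "card (P \<union> Q) \<le> 5 * t + 2"
    using P(2) Q(2) card_Un_le[of P Q] by linarith
  moreover have "separates (P \<union> Q) S"
  proof (rule ccontr)
    assume "\<not> separates (P \<union> Q) S"
    then obtain u v where uv: "u \<in> S" "u \<notin> P \<union> Q" "v \<in> V" "v \<notin> S" "v \<notin> P \<union> Q"
      and in_S: "\<forall>p\<in>P \<union> Q. p \<in> S \<longrightarrow> E u p \<noteq> E v p"
      and out_S: "\<forall>p\<in>P \<union> Q. p \<notin> S \<longrightarrow> E u p = E v p"
      by (rule not_separatesE)
    have ux: "E u x"
      using P(3) S(2)[OF uv(1) x] uv(2) by blast
    then have vx: "\<not> E v x"
      using in_S P(3) x by blast
    have ub: "E u b"
      using b(3) uv(1) by blast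
    then have vb: "E v b"
      using out_S Q(3) b(2) by blast
    have "E u v"
      using Q(4)[of u v] uv out_S vb sym by blast
    then have "E v x"
      using diamondD[of u b v x] ub ux vb b(3)[OF x] sym x uv(4) by blast
    then show False
      using vx by blast
  qed
  ultimately show ?thesis
    using P(1) Q(1) by (intro exI[of _ "P \<union> Q"]) auto
qed

text \<open>The new relation is the adjacency of \<open>G\<close>, since complementing a clique
  deletes its edges. A vertex outside a maximal clique \<open>S\<close> has at most one neighbour in
  \<open>S\<close>: two of them, a nonneighbour in \<open>S\<close> and the vertex would form a
  diamond. So no deleted edge joins two vertices with a common neighbour in the new graph, and the
  deletion creates neither a star nor a diamond.\<close>

lemma delete_maximal_clique:
  assumes S: "S \<subseteq> V" "\<And>u v. u \<in> S \<Longrightarrow> v \<in> S \<Longrightarrow> u \<noteq> v \<Longrightarrow> E u v"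
    and max: "\<And>b. b \<in> V \<Longrightarrow> b \<notin> S \<Longrightarrow> \<exists>u\<in>S. \<not> E u b"
  shows "star_free_adj t (\<lambda>u v. E u v \<and> \<not> (u \<in> S \<and> v \<in> S))"
    and "diamond_free_adj (\<lambda>u v. E u v \<and> \<not> (u \<in> S \<and> v \<in> S))"
proof -
  have one: "a = b" if w: "w \<notin> S" and ab: "a \<in> S" "b \<in> S" "E a w" "E b w" for w a b
  proof (rule ccontr)
    assume "a \<noteq> b"
    obtain c where c: "c \<in> S" "\<not> E c w"
      using max[OF EV w] ab by blast
    then have "a \<noteq> c" "b \<noteq> c"
      using ab by auto
    then show False
      using diamondD[of a b c w] S(2) ab \<open>a \<noteq> b\<close> c w by blast
  qed
  show "star_free_adj t (\<lambda>u v. E u v \<and> \<not> (u \<in> S \<and> v \<in> S))"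
    unfolding star_free_adj_def
  proof (intro notI, elim exE conjE)
    fix x I
    assume I: "card I = t" "\<forall>i\<in>I. E x i \<and> \<not> (x \<in> S \<and> i \<in> S)"
      "\<forall>i\<in>I. \<forall>j\<in>I. \<not> (E i j \<and> \<not> (i \<in> S \<and> j \<in> S))"
    have "\<not> E i j" if "i \<in> I" "j \<in> I" for i j
      using I(2,3) that one[of x i j] sym irrefl by blast
    then show False
      using I sfree unfolding star_free_adj_def by blast
  qed
  show "diamond_free_adj (\<lambda>u v. E u v \<and> \<not> (u \<in> S \<and> v \<in> S))"
    unfolding diamond_free_adj_def
  proof (intro allI impI)
    fix a b c d
    assume E: "E a b \<and> \<not> (a \<in> S \<and> b \<in> S)" "E a c \<and> \<not> (a \<in> S \<and> c \<in> S)"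
      "E a d \<and> \<not> (a \<in> S \<and> d \<in> S)" "E b c \<and> \<not> (b \<in> S \<and> c \<in> S)"
      "E b d \<and> \<not> (b \<in> S \<and> d \<in> S)" "c \<noteq> d"
    have "E c d"
      using E diamondD[of a b c d] by blast
    moreover have "\<not> (c \<in> S \<and> d \<in> S)"
      using E one[of a c d] sym by blast
    ultimately show "E c d \<and> \<not> (c \<in> S \<and> d \<in> S)" ..
  qed
qed

end

text \<open>If \<open>S\<close> has no separating set of this size, the two cases above show that
  \<open>S\<close> is a maximal clique of \<open>G \<oplus> S\<close>. Then \<open>G\<close> itself
  is in the class, so \<open>S' = {}\<close> is a solution, separated trivially by
  \<open>P = {}\<close>.\<close>

lemma ex_separated_solution:
  assumes G: "finite_simple_graph G" and t: "t \<ge> 1" and S: "S \<subseteq> verts G"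
    and free: "subgraph_complement G S \<in> free_graphs {star t, diamond}"
  obtains S' P where "S' \<subseteq> verts G" "subgraph_complement G S' \<in> free_graphs {star t, diamond}"
    "P \<subseteq> verts G" "card P \<le> 5 * t + 2"
    "\<And>u v. u \<in> S' - P \<Longrightarrow> v \<in> verts G - S' - P \<Longrightarrow>
       \<exists>p\<in>P. ({u, p} \<in> edges G) \<noteq> ({v, p} \<in> edges G)"
proof -
  define V where "V = verts G"
  define E where "E = (\<lambda>u v. {u, v} \<in> edges (subgraph_complement G S))"
  note simple = finite_simple_graph_subgraph_complement[OF G]
  interpret star_diamond_free V E t
  proof
    show "finite V"
      using G by (simp add: V_def finite_simple_graph_def)
    show "star_free_adj t E" "diamond_free_adj E"
      using free in_free_star_diamond_iff[OF simple t] unfolding E_def by blast+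
    show "v \<in> V" if "E u v" for u v
      using finite_simple_graph_edgeD(2)[OF simple, of u v S] that
      by (simp add: E_def V_def subgraph_complement_def)
    show "\<not> E u u" for u
      using finite_simple_graph_edgeD(3)[OF simple, of u u S] by (auto simp: E_def)
    show "E v u" if "E u v" for u v
      using that by (simp add: E_def insert_commute)
  qed
  have edge: "{u, v} \<in> edges G \<longleftrightarrow> u \<noteq> v \<and> (E u v \<longleftrightarrow> \<not> (u \<in> S \<and> v \<in> S))"
    if "u \<in> V" "v \<in> V" for u v
    using edge_subgraph_complement_iff[OF G, of u v S] that
      finite_simple_graph_edgeD(3)[OF G, of u v]
    unfolding E_def V_def by blast
  show ?thesis
  proof (cases "\<exists>P\<subseteq>V. card P \<le> 5 * t + 2 \<and> separates P S")
    case True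
    then obtain P where P: "P \<subseteq> V" "card P \<le> 5 * t + 2" "separates P S"
      by blast
    have "\<exists>p\<in>P. ({u, p} \<in> edges G) \<noteq> ({v, p} \<in> edges G)"
      if u: "u \<in> S - P" and v: "v \<in> V - S - P" for u v
    proof -
      obtain p where p: "p \<in> P" "p \<in> S \<longrightarrow> E u p = E v p" "p \<notin> S \<longrightarrow> E u p \<noteq> E v p"
        using P(3) u v unfolding separates_def by blast
      have "({u, p} \<in> edges G) \<noteq> ({v, p} \<in> edges G)"
        using edge[of u p] edge[of v p] p u v P(1) S unfolding V_def by blast
      then show ?thesis
        using p(1) by blast
    qed
    then show ?thesis
      using that[of S P] S free P unfolding V_def by blast
  next
    case False
    have clique: "E u v" if "u \<in> S" "v \<in> S" "u \<noteq> v" for u v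
      using ex_separating_set_if_not_clique[of u S v] that False S unfolding V_def by blast
    have max: "\<exists>u\<in>S. \<not> E u b" if "b \<in> V" "b \<notin> S" for b
    proof (rule ccontr)
      assume n: "\<not> (\<exists>u\<in>S. \<not> E u b)"
      show False
      \<comment> \<open>The empty set is separated by \<open>P = {}\<close>; otherwise any element
        of \<open>S\<close> can play the role of \<open>x\<close> in the extension lemma.\<close>
      proof (cases "S = {}")
        case True
        then have "separates {} S"
          by (simp add: separates_def)
        then show False
          using False by (metis card.empty empty_subsetI zero_le)
      next
        case ne: False
        then show False
          using ex_separating_set_if_clique_extends[of S b] clique n that S False
          unfolding V_def by blast
      qed
    qed
    \<comment> \<open>Complementing on the empty set returns the edges of \<open>G\<close>, which
      are those of \<open>G \<oplus> S\<close> without the clique on \<open>S\<close>.\<close>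
    have E_eq: "(\<lambda>u v. {u, v} \<in> edges (subgraph_complement G {})) =
        (\<lambda>u v. E u v \<and> \<not> (u \<in> S \<and> v \<in> S))"
    proof (intro ext)
      fix u v
      show "{u, v} \<in> edges (subgraph_complement G {}) \<longleftrightarrow> E u v \<and> \<not> (u \<in> S \<and> v \<in> S)"
      proof (cases "u \<in> V \<and> v \<in> V")
        case True
        then show ?thesis
          using edge_subgraph_complement_iff[OF G, of u v "{}"] edge[of u v] clique[of u v] irrefl
          unfolding V_def by blast
      next
        case False
        moreover have "u \<in> V \<and> v \<in> V" if "{u, v} \<in> edges (subgraph_complement G {})"
          using finite_simple_graph_edgeD[OF finite_simple_graph_subgraph_complement[OF G] that]
          by (simp add: V_def subgraph_complement_def)
        ultimately show ?thesis
          using EV sym by blast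
      qed
    qed
    have "subgraph_complement G {} \<in> free_graphs {star t, diamond}"
      unfolding in_free_star_diamond_iff[OF finite_simple_graph_subgraph_complement[OF G] t] E_eq
      using delete_maximal_clique[of S, OF _ clique max] S by (simp add: V_def)
    then show ?thesis
      using that[of "{}" "{}"] by simp
  qed
qed

section \<open>Evaluating first-order properties on the machine\<close>

lemma bit_length_le: "bit_length n \<le> Suc n"
proof (cases "n = 0")
  case False
  then show ?thesis
    using floor_log_exp2_le[of n] less_exp[of "floor_log n"] unfolding bit_length_def by linarith
qed (simp add: bit_length_def)

lemma runs_trans:
  assumes "runs P c k c'" "runs P c' k' c''"
  shows "runs P c (k + k') c''"
  using assms
  by induction (auto simp: add.assoc intro: runs.step)

text \<open>\<open>B\<close> is a uniform bound on the cost of one instruction, so \<open>m\<close>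
  plays the role of an instruction count and adds up under composition.\<close>

definition reaches :: "program \<Rightarrow> nat \<Rightarrow> nat \<Rightarrow> config \<Rightarrow> config \<Rightarrow> bool" where
  "reaches P B m c c' \<longleftrightarrow> (\<exists>k\<le>m * B. runs P c k c')"

lemma reaches_refl: "reaches P B m c c"
  unfolding reaches_def by (intro exI[of _ 0]) (simp add: runs.refl)

lemma reaches_step:
  assumes "reaches P B m (exec (P ! pc) (pc, R, M)) c'" "pc < length P"
    "cost (P ! pc) (pc, R, M) \<le> B"
  shows "reaches P B (Suc m) (pc, R, M) c'"
proof -
  obtain k where "k \<le> m * B" "runs P (exec (P ! pc) (pc, R, M)) k c'"
    using assms(1) unfolding reaches_def by blast
  then show ?thesis
    unfolding reaches_def using assms(2,3) runs.step[of "(pc, R, M)" P k c']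
    by (intro exI[of _ "cost (P ! pc) (pc, R, M) + k"]) auto
qed

lemma reaches_instr:
  assumes "pc < length P" "cost (P ! pc) (pc, R, M) \<le> B" "exec (P ! pc) (pc, R, M) = c'"
  shows "reaches P B 1 (pc, R, M) c'"
  unfolding One_nat_def using assms reaches_refl by (blast intro: reaches_step)

lemma reaches_trans:
  assumes "reaches P B m c c'" "reaches P B m' c' c''"
  shows "reaches P B (m + m') c c''"
proof -
  obtain k k' where "k \<le> m * B" "runs P c k c'" "k' \<le> m' * B" "runs P c' k' c''"
    using assms unfolding reaches_def by blast
  then show ?thesis
    unfolding reaches_def
    by (intro exI[of _ "k + k'"]) (auto simp: distrib_right intro: runs_trans)
qed

lemma reaches_mono: "reaches P B m c c' \<Longrightarrow> m \<le> m' \<Longrightarrow> reaches P B m' c c'"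
  unfolding reaches_def by (meson mult_le_mono1 order_trans)

section \<open>Program blocks and the invariants of registers and memory\<close>

fun code_at :: "program \<Rightarrow> nat \<Rightarrow> instr list \<Rightarrow> bool" where
  "code_at P a [] \<longleftrightarrow> True"
| "code_at P a (i # is) \<longleftrightarrow> a < length P \<and> P ! a = i \<and> code_at P (Suc a) is"

lemma code_at_append [simp]:
  "code_at P a (xs @ ys) \<longleftrightarrow> code_at P a xs \<and> code_at P (a + length xs) ys"
  by (induction xs arbitrary: a) auto

lemma code_at_self: "code_at P 0 P"
proof -
  have "code_at (xs @ ys) (length xs) ys" for xs ys :: program
  proof (induction ys arbitrary: xs)
    case (Cons y ys)
    show ?case
      using Cons[of "xs @ [y]"] by simp
  qed simp
  from this[of "[]" P] show ?thesis
    by simp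
qed

text \<open>
  Register 0 holds results, 1 the number \<open>n\<close> of vertices, 2 the constant 1, 3 the constant 0, and 4
  is scratch space. The value of the variable \<open>i\<close> is a vertex index in register \<open>2i + 5\<close>; \<open>n\<close> times
  this index is kept in register \<open>2i + 6\<close>, so that the adjacency matrix can be accessed without
  multiplication.
\<close>

definition reg_inv :: "nat \<Rightarrow> (nat \<Rightarrow> nat) \<Rightarrow> bool" where
  "reg_inv n R \<longleftrightarrow> 0 < n \<and> R 1 = n \<and> R 2 = 1 \<and> R 3 = 0 \<and> (\<forall>r. R r \<le> n * n)"

definition env_inv :: "nat \<Rightarrow> 'a list \<Rightarrow> (nat \<Rightarrow> nat) \<Rightarrow> (nat \<Rightarrow> 'a) \<Rightarrow> bool" where
  "env_inv d vs R e \<longleftrightarrow> (\<forall>i<d. R (2 * i + 5) < length vs \<and>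
     R (2 * i + 6) = R (2 * i + 5) * length vs \<and> e i = vs ! R (2 * i + 5))"

definition matrix_memory :: "'a graph \<Rightarrow> 'a list \<Rightarrow> (nat \<Rightarrow> nat) \<Rightarrow> bool" where
  "matrix_memory G vs M \<longleftrightarrow> finite_simple_graph G \<and> distinct vs \<and> set vs = verts G \<and>
     (\<forall>i<length vs. \<forall>j<length vs. M (i * length vs + j) = of_bool ({vs ! i, vs ! j} \<in> edges G))"

text \<open>
  The code \<open>c a\<close>, placed at position \<open>a\<close>, decides in polynomial time whether \<open>Q\<close> holds for a graph
  with \<open>d\<close> distinguished vertices.
\<close>

definition evaluates ::
    "(nat \<Rightarrow> program) \<Rightarrow> nat \<Rightarrow> nat poly \<Rightarrow> nat \<Rightarrow> ('a graph \<Rightarrow> (nat \<Rightarrow> 'a) \<Rightarrow> bool) \<Rightarrow> bool" where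
  "evaluates c l p d Q \<longleftrightarrow> (\<forall>a. length (c a) = l) \<and>
     (\<forall>a P G vs M R e n B. code_at P a (c a) \<longrightarrow> matrix_memory G vs M \<longrightarrow> reg_inv n R \<longrightarrow>
        env_inv d vs R e \<longrightarrow> n = length vs \<longrightarrow> B = 2 * (n * n) + 2 \<longrightarrow>
        (\<exists>R'. reaches P B (poly p (n * n)) (a, R, M) (a + l, R', M) \<and>
           reg_inv n R' \<and> (\<forall>r\<in>{5..<2 * d + 5}. R' r = R r) \<and> R' 0 = of_bool (Q G e)))"

lemma evaluatesI:
  assumes "\<And>a. length (c a) = l"
    and "\<And>a P G vs M R e n B. \<lbrakk>code_at P a (c a); matrix_memory G vs M; reg_inv n R;
      env_inv d vs R e; n = length vs; B = 2 * (n * n) + 2\<rbrakk> \<Longrightarrow>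
      \<exists>R'. reaches P B (poly p (n * n)) (a, R, M) (a + l, R', M) \<and>
        reg_inv n R' \<and> (\<forall>r\<in>{5..<2 * d + 5}. R' r = R r) \<and> R' 0 = of_bool (Q G e)"
  shows "evaluates c l p d Q"
  unfolding evaluates_def using assms by blast

lemma evaluates_length: "evaluates c l p d Q \<Longrightarrow> length (c a) = l"
  by (simp add: evaluates_def)

lemma evaluatesD:
  assumes "evaluates c l p d Q" "code_at P a (c a)" "matrix_memory G vs M" "reg_inv n R"
    "env_inv d vs R e" "n = length vs" "B = 2 * (n * n) + 2"
  obtains R' where "reaches P B (poly p (n * n)) (a, R, M) (a + l, R', M)" "reg_inv n R'"
    "\<forall>r\<in>{5..<2 * d + 5}. R' r = R r" "R' 0 = of_bool (Q G e)"
  using assms unfolding evaluates_def by blast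

definition decidable :: "nat \<Rightarrow> ('a graph \<Rightarrow> (nat \<Rightarrow> 'a) \<Rightarrow> bool) \<Rightarrow> bool" where
  "decidable d Q \<longleftrightarrow> (\<exists>c l p. evaluates c l p d Q)"

lemma decidableI: "evaluates c l p d Q \<Longrightarrow> decidable d Q"
  unfolding decidable_def by blast

lemma env_inv_cong:
  assumes "env_inv d vs R e" "\<forall>r\<in>{5..<2 * d + 5}. R' r = R r"
  shows "env_inv d vs R' e"
  using assms unfolding env_inv_def by simp

lemma env_inv_in_verts:
  "env_inv d vs R e \<Longrightarrow> i < d \<Longrightarrow> e i \<in> set vs"
  unfolding env_inv_def by auto

lemma bit_length_le_bound: "x \<le> L \<Longrightarrow> bit_length x \<le> 2 * L + 2"
  using bit_length_le[of x] by linarith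

text \<open>With \<open>L = n * n\<close> the right-hand side is the price \<open>B\<close> used in
  \<open>evaluates\<close>; an instruction handles at most two numbers, both bounded by
  \<open>n * n\<close>.\<close>

lemma bit_lengths_le_bound:
  "x \<le> L \<Longrightarrow> y \<le> L \<Longrightarrow> bit_length x + bit_length y \<le> 2 * L + 2"
  using bit_length_le[of x] bit_length_le[of y] by linarith

lemma decidable_cong:
  fixes Q Q' :: "'a graph \<Rightarrow> (nat \<Rightarrow> 'a) \<Rightarrow> bool"
  assumes "decidable d Q"
    and "\<And>G e. finite_simple_graph G \<Longrightarrow> (\<And>i. i < d \<Longrightarrow> e i \<in> verts G) \<Longrightarrow> Q G e \<longleftrightarrow> Q' G e"
  shows "decidable d Q'"
proof -
  obtain c l p where c: "evaluates c l p d Q"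
    using assms(1) unfolding decidable_def by blast
  show ?thesis
  proof (rule decidableI, rule evaluatesI[of c l d p, OF evaluates_length[OF c]], goal_cases)
    case (1 a P G vs M R e n B)
    have "finite_simple_graph G" "set vs = verts G"
      using 1(2) by (simp_all add: matrix_memory_def)
    then have eq: "Q G e \<longleftrightarrow> Q' G e"
      using env_inv_in_verts[OF 1(4)] by (intro assms(2)) auto
    from evaluatesD[OF c 1] show ?case
      unfolding eq by blast
  qed
qed

section \<open>Code for atoms, connectives and a quantifier\<close>

lemma decidable_adj:
  fixes i j d :: nat
  assumes "i < d" "j < d"
  shows "decidable d (\<lambda>(G :: 'a graph) e. {e i, e j} \<in> edges G)"
proof (rule decidableI, rule evaluatesI[of "\<lambda>_. [Add 0 (2 * i + 6) (2 * j + 5), Load 0 0]" 2 d "[:2:]"], goal_cases)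
  case (2 a P G vs M R e n B)
  \<comment> \<open>The row-major address of the matrix entry; register \<open>2 * i + 6\<close>
    already holds the row offset.\<close>
  define x where "x = R (2 * i + 5) * n + R (2 * j + 5)"
  have i: "R (2 * i + 5) < n" "R (2 * i + 6) = R (2 * i + 5) * n" "e i = vs ! R (2 * i + 5)"
    and j: "R (2 * j + 5) < n" "e j = vs ! R (2 * j + 5)"
    using 2 assms unfolding env_inv_def by auto
  have x: "R (2 * i + 6) + R (2 * j + 5) = x"
    by (simp add: x_def i)
  have Mx: "M x = of_bool ({e i, e j} \<in> edges G)"
    using 2 i j unfolding matrix_memory_def x_def by auto
  have "x < Suc (R (2 * i + 5)) * n"
    using j(1) by (simp add: x_def)
  also have "\<dots> \<le> n * n"
    using i(1) by (intro mult_le_mono1) simp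
  finally have xn: "x \<le> n * n"
    by simp
  have le: "R r \<le> n * n" for r
    using 2 unfolding reg_inv_def by auto
  have n1: "1 \<le> n * n"
    using 2 unfolding reg_inv_def by (simp add: Suc_le_eq)
  have "reaches P B (poly [:2:] (n * n)) (a, R, M) (a + 2, R(0 := M x), M)"
  proof -
    have instrs: "a < length P" "P ! a = Add 0 (2 * i + 6) (2 * j + 5)"
      "a + 1 < length P" "P ! (a + 1) = Load 0 0" and B: "B = 2 * (n * n) + 2"
      using 2 by simp_all
    have "reaches P B 1 (a, R, M) (a + 1, R(0 := x), M)"
      using instrs bit_lengths_le_bound[OF le le]
      by (intro reaches_instr) (simp_all add: B x)
    moreover have "reaches P B 1 (a + 1, R(0 := x), M) (a + 2, R(0 := M x), M)"
      using instrs bit_lengths_le_bound[OF xn, of "M x"] n1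
      by (intro reaches_instr) (simp_all add: B Mx)
    ultimately have "reaches P B (1 + 1) (a, R, M) (a + 2, R(0 := M x), M)"
      by (rule reaches_trans)
    then show ?thesis
      by (simp add: numeral_2_eq_2)
  qed
  moreover have "reg_inv n (R(0 := M x))"
    using 2 n1 by (auto simp: reg_inv_def Mx)
  ultimately show ?case
    by (intro exI[of _ "R(0 := M x)"]) (auto simp: Mx)
qed simp

text \<open>With truncated subtraction \<open>x - y + (y - x)\<close> is the distance of the
  indices, and 1 minus it is 1 exactly if they coincide. Indices may replace vertices because the
  enumeration is distinct.\<close>

lemma decidable_eq:
  fixes i j d :: nat
  assumes "i < d" "j < d"
  shows "decidable d (\<lambda>(G :: 'a graph) e. e i = e j)"
proof (rule decidableI, rule evaluatesI[of "\<lambda>_. [Sub 0 (2 * i + 5) (2 * j + 5), Sub 4 (2 * j + 5) (2 * i + 5),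
    Add 0 0 4, Sub 0 2 0]" 4 d "[:4:]"], goal_cases)
  case (2 a P G vs M R e n B)
  define x y where "x = R (2 * i + 5)" and "y = R (2 * j + 5)"
  have xy: "x < n" "e i = vs ! x" "y < n" "e j = vs ! y"
    using 2 assms unfolding env_inv_def x_def y_def by auto
  have eq: "e i = e j \<longleftrightarrow> x = y"
    using 2 xy by (auto simp: matrix_memory_def nth_eq_iff_index_eq)
  have "n \<le> n * n"
    by (cases n) auto
  then have le: "x \<le> n * n" "y \<le> n * n" "x - y \<le> n * n" "y - x \<le> n * n" "1 \<le> n * n"
    "x - y + (y - x) \<le> n * n"
    using xy by linarith+
  let ?R = "R(0 := of_bool (x = y), 4 := y - x)"
  have R2: "R 2 = 1"
    using 2 by (auto simp: reg_inv_def)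
  have ob: "1 - (x - y + (y - x)) = of_bool (x = y)"
    by auto
  have "reaches P B (poly [:4:] (n * n)) (a, R, M) (a + 4, ?R, M)"
  proof -
    have instrs: "a < length P" "P ! a = Sub 0 (2 * i + 5) (2 * j + 5)"
      "a + 1 < length P" "P ! (a + 1) = Sub 4 (2 * j + 5) (2 * i + 5)"
      "a + 2 < length P" "P ! (a + 2) = Add 0 0 4"
      "a + 3 < length P" "P ! (a + 3) = Sub 0 2 0"
      using 2(1) by (simp_all add: numeral_eq_Suc)
    have B: "B = 2 * (n * n) + 2"
      using 2 by simp
    have "reaches P B 1 (a, R, M) (a + 1, R(0 := x - y), M)"
      using instrs bit_lengths_le_bound[OF le(1,2)]
      by (intro reaches_instr) (simp_all add: B x_def y_def)
    moreover have "reaches P B 1 (a + 1, R(0 := x - y), M) (a + 2, R(0 := x - y, 4 := y - x), M)"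
      using instrs bit_lengths_le_bound[OF le(2,1)]
      by (intro reaches_instr) (simp_all add: B x_def y_def)
    moreover have "reaches P B 1 (a + 2, R(0 := x - y, 4 := y - x), M)
        (a + 3, R(0 := x - y + (y - x), 4 := y - x), M)"
      using instrs bit_lengths_le_bound[OF le(3,4)]
      by (intro reaches_instr) (simp_all add: B fun_upd_twist)
    moreover have "reaches P B 1 (a + 3, R(0 := x - y + (y - x), 4 := y - x), M) (a + 4, ?R, M)"
      using instrs bit_lengths_le_bound[OF le(5,6)]
      by (intro reaches_instr) (simp_all add: B R2 fun_upd_twist flip: ob)
    ultimately have "reaches P B (1 + 1 + 1 + 1) (a, R, M) (a + 4, ?R, M)"
      by (intro reaches_trans)
    moreover have "poly [:4:] (n * n) = 1 + 1 + 1 + 1"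
      by simp
    ultimately show ?thesis
      by (simp only:)
  qed
  moreover have "reg_inv n ?R"
    using 2 le by (auto simp: reg_inv_def)
  ultimately show ?case
    by (intro exI[of _ ?R]) (auto simp: eq)
qed simp

lemma decidable_not:
  fixes Q :: "'a graph \<Rightarrow> (nat \<Rightarrow> 'a) \<Rightarrow> bool"
  assumes "decidable d Q"
  shows "decidable d (\<lambda>G e. \<not> Q G e)"
proof -
  obtain c l p where c: "evaluates c l p d Q"
    using assms unfolding decidable_def by blast
  note len = evaluates_length[OF c]
  show ?thesis
  proof (rule decidableI, rule evaluatesI[of "\<lambda>a. c a @ [Sub 0 2 0]" "l + 1" d "p + [:1:]"], goal_cases)
    case (2 a P G vs M R e n B)
    have "code_at P a (c a)"
      using 2(1) by simp
    from evaluatesD[OF c this 2(2-)] obtain R' where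
      R': "reaches P B (poly p (n * n)) (a, R, M) (a + l, R', M)" "reg_inv n R'"
        "\<forall>r\<in>{5..<2 * d + 5}. R' r = R r" "R' 0 = of_bool (Q G e)"
      by blast
    let ?R = "R'(0 := of_bool (\<not> Q G e))"
    have n1: "1 \<le> n * n" and R2: "R' 2 = 1"
      using R' by (simp_all add: reg_inv_def Suc_le_eq)
    have "1 - of_bool (Q G e) = (of_bool (\<not> Q G e) :: nat)"
      by simp
    then have "reaches P B 1 (a + l, R', M) (a + (l + 1), ?R, M)"
      using 2 R' R2 n1 len bit_lengths_le_bound[OF n1, of "of_bool (Q G e)"]
      by (intro reaches_instr) auto
    from reaches_trans[OF R'(1) this]
    have "reaches P B (poly (p + [:1:]) (n * n)) (a, R, M) (a + (l + 1), ?R, M)"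
      by simp
    moreover have "reg_inv n ?R"
      using R' n1 by (auto simp: reg_inv_def)
    ultimately show ?case
      using R' by (intro exI[of _ ?R]) auto
  qed (simp add: len)
qed

text \<open>If the first result is 0, the jump skips the second block and register 0 already holds
  the answer.\<close>

lemma decidable_conj:
  fixes Q Q' :: "'a graph \<Rightarrow> (nat \<Rightarrow> 'a) \<Rightarrow> bool"
  assumes "decidable d Q" "decidable d Q'"
  shows "decidable d (\<lambda>G e. Q G e \<and> Q' G e)"
proof -
  obtain c l p where c: "evaluates c l p d Q"
    using assms(1) unfolding decidable_def by blast
  obtain c' l' p' where c': "evaluates c' l' p' d Q'"
    using assms(2) unfolding decidable_def by blast
  note len = evaluates_length[OF c] evaluates_length[OF c']
  show ?thesis
  proof (rule decidableI, rule evaluatesI[of "\<lambda>a. c a @ JumpZero 0 (a + (l + 1 + l')) # c' (Suc (a + l))"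
      "l + 1 + l'" d "p + [:1:] + p'"], goal_cases)
    case (2 a P G vs M R e n B)
    have "code_at P a (c a)"
      using 2(1) by simp
    from evaluatesD[OF c this 2(2-)] obtain R' where
      R': "reaches P B (poly p (n * n)) (a, R, M) (a + l, R', M)" "reg_inv n R'"
        "\<forall>r\<in>{5..<2 * d + 5}. R' r = R r" "R' 0 = of_bool (Q G e)"
      by blast
    have n1: "1 \<le> n * n"
      using R' by (simp add: reg_inv_def Suc_le_eq)
    have jump: "reaches P B 1 (a + l, R', M)
        (if Q G e then Suc (a + l) else a + (l + 1 + l'), R', M)"
      using 2(1,6) R' n1 len bit_length_le_bound[of "of_bool (Q G e)" "n * n"]
      by (intro reaches_instr) auto
    note start = reaches_trans[OF R'(1) jump]
    show ?case
    proof (cases "Q G e")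
      case True
      have "code_at P (Suc (a + l)) (c' (Suc (a + l)))"
        using 2(1) len by simp
      from evaluatesD[OF c' this 2(2) R'(2) env_inv_cong[OF 2(4) R'(3)] 2(5,6)] obtain R'' where
        R'': "reaches P B (poly p' (n * n)) (Suc (a + l), R', M) (Suc (a + l) + l', R'', M)"
          "reg_inv n R''" "\<forall>r\<in>{5..<2 * d + 5}. R'' r = R' r" "R'' 0 = of_bool (Q' G e)"
        by blast
      have "reaches P B (poly (p + [:1:] + p') (n * n)) (a, R, M) (a + (l + 1 + l'), R'', M)"
        using reaches_trans[OF start, of "poly p' (n * n)"] R''(1) True by (simp add: add.assoc)
      then show ?thesis
        using R' R'' True by auto
    next
      case False
      have "reaches P B (poly (p + [:1:] + p') (n * n)) (a, R, M) (a + (l + 1 + l'), R', M)"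
        using start False by (auto elim!: reaches_mono)
      then show ?thesis
        using R' False by auto
    qed
  qed (simp add: len)
qed

text \<open>A loop lets variable \<open>d\<close> run through the \<open>n\<close> indices and stops
  early at a witness. The bound is a polynomial in \<open>n * n\<close>, hence the factor
  \<open>[:0, 1:]\<close> where there are only \<open>n\<close> rounds.\<close>

lemma decidable_ex:
  fixes Q :: "'a graph \<Rightarrow> (nat \<Rightarrow> 'a) \<Rightarrow> bool"
  assumes "decidable (Suc d) Q"
  shows "decidable d (\<lambda>G e. \<exists>v\<in>verts G. Q G (e(d := v)))"
proof -
  obtain c l p where c: "evaluates c l p (Suc d) Q"
    using assms unfolding decidable_def by blast
  note len = evaluates_length[OF c]
  define x where "x = 2 * d + 5"
  \<comment> \<open>Register 3 holds 0, so \<open>JumpZero 3\<close> always jumps. Register 0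
    receives \<open>n\<close> minus the next index: when this is 0 the loop ends, and 0 is also the
    correct negative answer.\<close>
  define code where "code a = [Const x 0, Const (Suc x) 0] @ c (a + 2) @
    [JumpZero 0 (a + l + 4), JumpZero 3 (a + l + 9), Add x x 2, Add (Suc x) (Suc x) 1,
     Sub 0 1 x, JumpZero 0 (a + l + 9), JumpZero 3 (a + 2)]" for a
  show ?thesis
  proof (rule decidableI, rule evaluatesI[of code "l + 9" d "[:2:] + [:0, 1:] * (p + [:6:])"], goal_cases)
    case (2 a P G vs M R e n B)
    have lvs: "n = length vs" and B: "B = 2 * (n * n) + 2"
      using 2 by auto
    define q where "q m \<longleftrightarrow> Q G (e(d := vs ! m))" for m
    have set_vs: "set vs = verts G"
      using 2 by (simp add: matrix_memory_def)
    have code: "code_at P (a + 2) (c (a + 2))"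
      using 2(1) by (simp add: code_def)
    have instrs:
      "a < length P" "P ! a = Const x 0"
      "Suc a < length P" "P ! Suc a = Const (Suc x) 0"
      "a + l + 2 < length P" "P ! (a + l + 2) = JumpZero 0 (a + l + 4)"
      "a + l + 3 < length P" "P ! (a + l + 3) = JumpZero 3 (a + l + 9)"
      "a + l + 4 < length P" "P ! (a + l + 4) = Add x x 2"
      "a + l + 5 < length P" "P ! (a + l + 5) = Add (Suc x) (Suc x) 1"
      "a + l + 6 < length P" "P ! (a + l + 6) = Sub 0 1 x"
      "a + l + 7 < length P" "P ! (a + l + 7) = JumpZero 0 (a + l + 9)"
      "a + l + 8 < length P" "P ! (a + l + 8) = JumpZero 3 (a + 2)"
      using 2(1) by (simp_all add: code_def len numeral_eq_Suc)
    \<comment> \<open>Here \<open>k\<close> counts the indices left and \<open>n - k\<close> is the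
      current one; \<open>0 < k\<close> because the end of the range is tested only after the
      body.\<close>
    have loop: "\<exists>R'. reaches P B (k * (poly p (n * n) + 6)) (a + 2, R, M) (a + l + 9, R', M) \<and>
        reg_inv n R' \<and> (\<forall>r\<in>{5..<2 * d + 5}. R' r = R r) \<and>
        R' 0 = of_bool (\<exists>m\<in>{n - k..<n}. q m)"
      if "0 < k" "k \<le> n" "reg_inv n R" "env_inv d vs R e" "R x = n - k" "R (Suc x) = (n - k) * n"
      for k R
      using that
    proof (induction k arbitrary: R)
      case (Suc k)
      define m where "m = n - Suc k"
      have m: "m < n" "R x = m" "R (Suc x) = m * n" "n - k = Suc m" "n - Suc k = m"
        using Suc.prems by (auto simp: m_def)
      have "env_inv (Suc d) vs R (e(d := vs ! m))"
        unfolding env_inv_def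
      proof (intro allI impI)
        fix i assume "i < Suc d"
        have x: "2 * d + 5 = x" "2 * d + 6 = Suc x"
          by (simp_all add: x_def)
        show "R (2 * i + 5) < length vs \<and> R (2 * i + 6) = R (2 * i + 5) * length vs \<and>
            (e(d := vs ! m)) i = vs ! R (2 * i + 5)"
          using \<open>i < Suc d\<close> Suc.prems(4) m lvs unfolding env_inv_def
          by (cases "i = d") (simp_all add: x)
      qed
      from evaluatesD[OF c code 2(2) Suc.prems(3) this lvs B] obtain R' where
        R': "reaches P B (poly p (n * n)) (a + 2, R, M) (a + 2 + l, R', M)" "reg_inv n R'"
          "\<forall>r\<in>{5..<2 * Suc d + 5}. R' r = R r" "R' 0 = of_bool (q m)"
        unfolding q_def by blast
      have R'x: "R' x = m" "R' (Suc x) = m * n"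
        using R'(3) m by (auto simp: x_def)
      have R'_const: "R' (Suc 0) = n" "R' 2 = 1" "R' 3 = 0"
        using R'(2) by (auto simp: reg_inv_def)
      have x_ne: "x \<noteq> 0" "x \<noteq> Suc 0" "x \<noteq> 2" "x \<noteq> 3" "Suc x \<noteq> 2" "Suc x \<noteq> 3" "x \<noteq> 1" "3 \<noteq> x" "2 \<noteq> x"
        by (auto simp: x_def)
      have nn: "n \<le> n * n" "1 \<le> n * n"
        using m(1) by (cases n; simp)+
      have mn: "Suc m * n \<le> n * n"
        using m(1) by (intro mult_le_mono1) simp
      have le: "m \<le> n * n" "Suc m \<le> n * n" "n \<le> n * n" "m * n \<le> n * n" "0 \<le> n * n" "n - Suc m \<le> n * n"
        using nn mn m(1) by auto
      have range: "{m..<n} = insert m {Suc m..<n}"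
        using m(1) by auto
      show ?case
      proof (cases "q m")
        case True
        have "reaches P B 1 (a + 2 + l, R', M) (a + l + 3, R', M)"
          using instrs R'(4) True bit_length_le_bound[OF nn(2)]
          by (intro reaches_instr) (auto simp: B add.commute[of 2 l] add.assoc)
        moreover have "reaches P B 1 (a + l + 3, R', M) (a + l + 9, R', M)"
          using instrs R'_const bit_length_le_bound[OF le(5)]
          by (intro reaches_instr) (auto simp: B)
        ultimately have "reaches P B (poly p (n * n) + (1 + 1)) (a + 2, R, M) (a + l + 9, R', M)"
          using R'(1) reaches_trans by blast
        then have "reaches P B (Suc k * (poly p (n * n) + 6)) (a + 2, R, M) (a + l + 9, R', M)"
          by (rule reaches_mono) simp
        then show ?thesis
          using R' True m by (intro exI[of _ R']) (auto simp: range)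
      next
        case False
        define R'' where "R'' = R'(x := Suc m, Suc x := Suc m * n, 0 := n - Suc m)"
        have R''_eq: "R'(x := Suc m, Suc x := m * n + n, 0 := n - Suc m) = R''"
          by (simp add: R''_def add.commute)
        have body: "reaches P B 5 (a + l + 2, R', M)
            (if k = 0 then a + l + 9 else a + l + 8, R'', M)"
        proof -
          have k: "n - Suc m = k"
            using m Suc.prems(2) by linarith
          have "reaches P B 1 (a + l + 2, R', M) (a + l + 4, R', M)"
            using instrs(5,6) R'(4) False bit_length_le_bound[OF le(5)]
            by (intro reaches_instr) (simp_all add: B)
          moreover have "reaches P B 1 (a + l + 4, R', M) (a + l + 5, R'(x := Suc m), M)"
            using instrs(9,10) R'x R'_const bit_lengths_le_bound[OF le(1) nn(2)]
            by (intro reaches_instr) (simp_all add: B)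
          moreover have "reaches P B 1 (a + l + 5, R'(x := Suc m), M)
              (a + l + 6, R'(x := Suc m, Suc x := m * n + n), M)"
            using instrs(11,12) R'x R'_const x_ne bit_lengths_le_bound[OF le(4,3)]
            by (intro reaches_instr) (simp_all add: B)
          moreover have "reaches P B 1 (a + l + 6, R'(x := Suc m, Suc x := m * n + n), M)
              (a + l + 7, R'', M)"
            using instrs(13,14) R'x R'_const x_ne bit_lengths_le_bound[OF le(3,2)]
            by (intro reaches_instr) (simp_all add: B flip: R''_eq)
          moreover have "reaches P B 1 (a + l + 7, R'', M)
              (if k = 0 then a + l + 9 else a + l + 8, R'', M)"
            using instrs(15,16) bit_length_le_bound[OF le(6)] k
            by (intro reaches_instr) (simp_all add: B R''_def)
          ultimately have "reaches P B (1 + 1 + 1 + 1 + 1) (a + l + 2, R', M)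
              (if k = 0 then a + l + 9 else a + l + 8, R'', M)"
            by (intro reaches_trans)
          then show ?thesis
            by (simp add: numeral_eq_Suc)
        qed
        have R''_inv: "reg_inv n R''"
        proof -
          have "\<forall>r. R' r \<le> n * n" "0 < n"
            using R'(2) by (simp_all add: reg_inv_def)
          then have "\<forall>r. R'' r \<le> n * n"
            unfolding R''_def fun_upd_apply using le(2,6) mn by presburger
          then show ?thesis
            using R'_const x_ne \<open>0 < n\<close> by (simp add: reg_inv_def R''_def)
        qed
        have R''_keep: "\<forall>r\<in>{5..<2 * d + 5}. R'' r = R r"
          using R'(3) by (auto simp: R''_def x_def)
        have "reaches P B (poly p (n * n)) (a + 2, R, M) (a + l + 2, R', M)"
          using R'(1) by (simp add: add.commute add.left_commute)
        note start = reaches_trans[OF this body]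
        show ?thesis
        proof (cases "k = 0")
          case True
          then have "n = Suc m"
            using m by linarith
          moreover have "reaches P B (Suc k * (poly p (n * n) + 6)) (a + 2, R, M) (a + l + 9, R'', M)"
            using start True by (auto elim!: reaches_mono)
          moreover have "R'' 0 = of_bool (\<exists>m\<in>{n - Suc k..<n}. q m)"
            unfolding m(5) range using False \<open>n = Suc m\<close> by (simp add: R''_def)
          ultimately show ?thesis
            using R''_inv R''_keep by blast
        next
          case k: False
          have jump: "reaches P B 1 (a + l + 8, R'', M) (a + 2, R'', M)"
            using instrs(17,18) R'_const x_ne bit_length_le_bound[OF le(5)]
            by (intro reaches_instr) (simp_all add: B R''_def)
          have "\<exists>S. reaches P B (k * (poly p (n * n) + 6)) (a + 2, R'', M) (a + l + 9, S, M) \<and>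
              reg_inv n S \<and> (\<forall>r\<in>{5..<2 * d + 5}. S r = R'' r) \<and>
              S 0 = of_bool (\<exists>m\<in>{n - k..<n}. q m)"
          proof (rule Suc.IH)
            show "env_inv d vs R'' e"
              using env_inv_cong[OF Suc.prems(4) R''_keep] .
            show "reg_inv n R''"
              by (rule R''_inv)
            show "0 < k" "k \<le> n"
              using k Suc.prems(2) by simp_all
            show "R'' x = n - k" "R'' (Suc x) = (n - k) * n"
              using x_ne unfolding m(4) by (simp_all add: R''_def)
          qed
          then obtain S where S: "reaches P B (k * (poly p (n * n) + 6)) (a + 2, R'', M) (a + l + 9, S, M)"
            "reg_inv n S" "\<forall>r\<in>{5..<2 * d + 5}. S r = R'' r"
            "S 0 = of_bool (\<exists>m\<in>{n - k..<n}. q m)"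
            by blast
          have "reaches P B (poly p (n * n) + 5) (a + 2, R, M) (a + l + 8, R'', M)"
            using start k by simp
          from reaches_trans[OF this reaches_trans[OF jump S(1)]]
          have "reaches P B (Suc k * (poly p (n * n) + 6)) (a + 2, R, M) (a + l + 9, S, M)"
            by (rule reaches_mono) simp
          moreover have "S 0 = of_bool (\<exists>m\<in>{n - Suc k..<n}. q m)"
            using S(4) False unfolding m(4,5) range by simp
          ultimately show ?thesis
            using S(2,3) R''_keep by (intro exI[of _ S]) simp
        qed
      qed
    qed simp
    define R0 where "R0 = R(x := 0, Suc x := 0)"
    have B1: "bit_length 0 \<le> B"
      by (simp add: B bit_length_def)
    have init: "reaches P B 2 (a, R, M) (a + 2, R0, M)"
    proof -
      have "reaches P B 1 (a, R, M) (Suc a, R(x := 0), M)"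
        using instrs B1 by (intro reaches_instr) auto
      moreover have "reaches P B 1 (Suc a, R(x := 0), M) (a + 2, R0, M)"
        using instrs B1 by (intro reaches_instr) (auto simp: R0_def)
      ultimately show ?thesis
        using reaches_trans by (metis one_add_one)
    qed
    have n: "0 < n"
      using 2 by (simp add: reg_inv_def)
    have keep: "\<forall>r\<in>{5..<2 * d + 5}. R0 r = R r"
      by (auto simp: R0_def x_def)
    have "\<exists>R'. reaches P B (n * (poly p (n * n) + 6)) (a + 2, R0, M) (a + l + 9, R', M) \<and>
        reg_inv n R' \<and> (\<forall>r\<in>{5..<2 * d + 5}. R' r = R0 r) \<and>
        R' 0 = of_bool (\<exists>m\<in>{n - n..<n}. q m)"
    proof (rule loop)
      show "env_inv d vs R0 e"
        using env_inv_cong[OF 2(4) keep] .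
      show "reg_inv n R0"
        using 2 by (auto simp: reg_inv_def R0_def x_def)
    qed (use n in \<open>auto simp: R0_def\<close>)
    then obtain R' where
      R': "reaches P B (n * (poly p (n * n) + 6)) (a + 2, R0, M) (a + l + 9, R', M)"
        "reg_inv n R'" "\<forall>r\<in>{5..<2 * d + 5}. R' r = R0 r"
        "R' 0 = of_bool (\<exists>m\<in>{n - n..<n}. q m)"
      by blast
    have "2 + n * (poly p (n * n) + 6) \<le> poly ([:2:] + [:0, 1:] * (p + [:6:])) (n * n)"
    proof -
      have "n * (poly p (n * n) + 6) \<le> n * n * (poly p (n * n) + 6)"
        using n by (intro mult_le_mono1) simp
      then show ?thesis
        by simp
    qed
    then have "reaches P B (poly ([:2:] + [:0, 1:] * (p + [:6:])) (n * n)) (a, R, M) (a + (l + 9), R', M)"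
      using reaches_mono[OF reaches_trans[OF init R'(1)]] by (simp add: add.assoc)
    moreover have "(\<exists>m\<in>{n - n..<n}. q m) \<longleftrightarrow> (\<exists>v\<in>verts G. Q G (e(d := v)))"
    proof -
      have "verts G = (!) vs ` {0..<n}"
        unfolding set_vs[symmetric] lvs by (auto simp: set_conv_nth)
      then show ?thesis
        by (simp add: q_def)
    qed
    ultimately show ?case
      using R' keep by (intro exI[of _ R']) simp
  qed (simp add: code_def len)
qed

section \<open>Derived connectives and blocks of quantifiers\<close>

lemma decidable_const:
  "decidable d (\<lambda>(G :: 'a graph) e. b)"
proof (rule decidableI, rule evaluatesI[of "\<lambda>_. [Const 0 (of_bool b)]" 1 d "[:1:]"], goal_cases)
  case (2 a P G vs M R e n B)
  have n1: "1 \<le> n * n"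
    using 2 by (simp add: reg_inv_def Suc_le_eq)
  have "reaches P B 1 (a, R, M) (a + 1, R(0 := of_bool b), M)"
    using 2 bit_length_le_bound[of "of_bool b" "n * n"] n1 by (intro reaches_instr) simp_all
  moreover have "reg_inv n (R(0 := of_bool b))"
    using 2 n1 by (simp add: reg_inv_def)
  ultimately show ?case
    by (intro exI[of _ "R(0 := of_bool b)"]) simp
qed simp

lemma decidable_iff:
  assumes "decidable d Q" "decidable d Q'"
  shows "decidable d (\<lambda>G e. Q G e \<longleftrightarrow> Q' G e)"
proof (rule decidable_cong)
  show "decidable d (\<lambda>G e. \<not> (Q G e \<and> \<not> Q' G e) \<and> \<not> (Q' G e \<and> \<not> Q G e))"
    using assms by (intro decidable_conj decidable_not)
qed blast

lemma decidable_ball_finite: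
  assumes "finite I" "\<And>i. i \<in> I \<Longrightarrow> decidable d (Q i)"
  shows "decidable d (\<lambda>G e. \<forall>i\<in>I. Q i G e)"
  using assms
proof (induction I)
  case (insert i I)
  then have "decidable d (\<lambda>G e. Q i G e \<and> (\<forall>i\<in>I. Q i G e))"
    by (intro decidable_conj) auto
  then show ?case
    by simp
qed (simp add: decidable_const)

lemma decidable_bex_finite:
  assumes "finite I" "\<And>i. i \<in> I \<Longrightarrow> decidable d (Q i)"
  shows "decidable d (\<lambda>G e. \<exists>i\<in>I. Q i G e)"
proof (rule decidable_cong)
  show "decidable d (\<lambda>G e. \<not> (\<forall>i\<in>I. \<not> Q i G e))"
    using assms by (intro decidable_not decidable_ball_finite)
qed blast

lemma finite_bool_lists: "finite {bs :: bool list. length bs = k}"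
  using finite_lists_length_eq[of "UNIV :: bool set" k] by simp

text \<open>Disjunctive normal form: the finitely many rows of length \<open>N\<close> in the truth
  table \<open>T\<close> are tested one by one. \<open>T\<close> may be arbitrary, being a constant
  of the program.\<close>

lemma decidable_bool_fun:
  assumes "\<And>i. i < N \<Longrightarrow> decidable d (Q i)"
  shows "decidable d (\<lambda>G e. map (\<lambda>i. Q i G e) [0..<N] \<in> T)"
proof (rule decidable_cong)
  show "decidable d (\<lambda>G e. \<exists>bs\<in>T \<inter> {bs. length bs = N}. \<forall>i\<in>{..<N}. Q i G e \<longleftrightarrow> bs ! i)"
    using assms
    by (intro decidable_bex_finite decidable_ball_finite decidable_iff decidable_const
        finite_Int disjI2 finite_bool_lists) auto
next
  fix G and e
  define cs where "cs = map (\<lambda>i. Q i G e) [0..<N]"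
  have "length cs = N"
    by (simp add: cs_def)
  moreover have "(\<forall>i\<in>{..<N}. Q i G e \<longleftrightarrow> bs ! i) \<longleftrightarrow> cs = bs" if "length bs = N" for bs
    using that by (auto simp: list_eq_iff_nth_eq cs_def)
  ultimately have "(\<exists>bs\<in>T \<inter> {bs. length bs = N}. \<forall>i\<in>{..<N}. Q i G e \<longleftrightarrow> bs ! i) \<longleftrightarrow> cs \<in> T"
    by auto
  then show "(\<exists>bs\<in>T \<inter> {bs. length bs = N}. \<forall>i\<in>{..<N}. Q i G e \<longleftrightarrow> bs ! i) \<longleftrightarrow>
      map (\<lambda>i. Q i G e) [0..<N] \<in> T"
    by (simp only: cs_def)
qed

text \<open>The \<open>k\<close> variables occupy positions \<open>d\<close> to
  \<open>d + k - 1\<close>; the induction step strips the last one, the innermost quantifier, by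
  \<open>decidable_ex\<close>.\<close>

lemma decidable_ex_many:
  assumes "decidable (d + k) Q"
  shows "decidable d (\<lambda>G e. \<exists>f. (\<forall>i\<in>{d..<d + k}. f i \<in> verts G) \<and> Q G (override_on e f {d..<d + k}))"
  using assms
proof (induction k arbitrary: Q)
  case (Suc k)
  have "decidable (d + k) (\<lambda>G e. \<exists>v\<in>verts G. Q G (e(d + k := v)))"
    using Suc.prems by (intro decidable_ex) simp
  note IH = Suc.IH[OF this]
  have range: "{d..<d + Suc k} = insert (d + k) {d..<d + k}"
    by auto
  show ?case
  proof (rule decidable_cong[OF IH], rule iffI)
    fix G and e :: "nat \<Rightarrow> 'a"
    {
      assume "\<exists>f. (\<forall>i\<in>{d..<d + k}. f i \<in> verts G) \<and>
        (\<exists>v\<in>verts G. Q G ((override_on e f {d..<d + k})(d + k := v)))"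
      then obtain f v where f: "\<forall>i\<in>{d..<d + k}. f i \<in> verts G" "v \<in> verts G"
        "Q G ((override_on e f {d..<d + k})(d + k := v))"
        by blast
      moreover have "(override_on e f {d..<d + k})(d + k := v) =
          override_on e (f(d + k := v)) {d..<d + Suc k}"
        by (auto simp: override_on_def fun_eq_iff)
      ultimately show "\<exists>f. (\<forall>i\<in>{d..<d + Suc k}. f i \<in> verts G) \<and>
          Q G (override_on e f {d..<d + Suc k})"
        unfolding range by (intro exI[of _ "f(d + k := v)"]) auto
    }
    assume "\<exists>f. (\<forall>i\<in>{d..<d + Suc k}. f i \<in> verts G) \<and> Q G (override_on e f {d..<d + Suc k})"
    then obtain f where f: "\<forall>i\<in>{d..<d + Suc k}. f i \<in> verts G"
      "Q G (override_on e f {d..<d + Suc k})"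
      by blast
    moreover have "override_on e f {d..<d + Suc k} =
        (override_on e f {d..<d + k})(d + k := f (d + k))"
      by (auto simp: override_on_def fun_eq_iff)
    ultimately show "\<exists>f. (\<forall>i\<in>{d..<d + k}. f i \<in> verts G) \<and>
        (\<exists>v\<in>verts G. Q G ((override_on e f {d..<d + k})(d + k := v)))"
      unfolding range by (intro exI[of _ f]) auto
  qed
qed simp

section \<open>The decision procedure\<close>

text \<open>
  The first \<open>N\<close> entries record with which of the parameters \<open>e 0, \<dots>, e (N - 1)\<close> the vertex \<open>v\<close>
  coincides, the other \<open>N\<close> entries to which of them it is adjacent.
\<close>

definition vertex_type :: "nat \<Rightarrow> 'a graph \<Rightarrow> (nat \<Rightarrow> 'a) \<Rightarrow> 'a \<Rightarrow> bool list" where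
  "vertex_type N G e v =
     map (\<lambda>i. if i < N then v = e i else {v, e (i - N)} \<in> edges G) [0..<2 * N]"

text \<open>A union of atomic types over the parameters. \<open>T\<close> is built into the formula
  and only the parameters are quantified, which replaces the quantifier over sets \<open>S\<close>
  by quantifiers over vertices.\<close>

definition typed_verts :: "nat \<Rightarrow> bool list set \<Rightarrow> 'a graph \<Rightarrow> (nat \<Rightarrow> 'a) \<Rightarrow> 'a set" where
  "typed_verts N T G e = {v \<in> verts G. vertex_type N G e v \<in> T}"

lemma decidable_typed_verts:
  assumes "N \<le> d" "j < d"
  shows "decidable d (\<lambda>(G :: 'a graph) e. e j \<in> typed_verts N T G e)"
proof (rule decidable_cong)
  show "decidable d (\<lambda>(G :: 'a graph) e. map (\<lambda>i. if i < N then e j = e i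
      else {e j, e (i - N)} \<in> edges G) [0..<2 * N] \<in> T)"
  proof (rule decidable_bool_fun)
    fix i assume i: "i < 2 * N"
    show "decidable d (\<lambda>(G :: 'a graph) e. if i < N then e j = e i else {e j, e (i - N)} \<in> edges G)"
      using i assms by (cases "i < N") (simp_all add: decidable_eq decidable_adj)
  qed
qed (use assms in \<open>auto simp: typed_verts_def vertex_type_def\<close>)

lemma decidable_complement_edge:
  assumes "N \<le> d" "i < d" "j < d"
  shows "decidable d (\<lambda>(G :: 'a graph) e.
    {e i, e j} \<in> edges (subgraph_complement G (typed_verts N T G e)))"
proof (rule decidable_cong)
  show "decidable d (\<lambda>(G :: 'a graph) e. \<not> e i = e j \<and> ({e i, e j} \<in> edges G \<longleftrightarrow>
      \<not> (e i \<in> typed_verts N T G e \<and> e j \<in> typed_verts N T G e)))"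
    using assms
    by (intro decidable_conj decidable_not decidable_iff decidable_eq decidable_adj
        decidable_typed_verts)
qed (use assms in \<open>simp add: edge_subgraph_complement_iff\<close>)

text \<open>The \<open>k\<close> vertices of the copy follow the \<open>N\<close> parameters.
  Injectivity is expressed as an equality pattern, so the condition is a finite conjunction over all
  pairs of positions.\<close>

lemma decidable_embeds:
  fixes H :: "nat graph"
  assumes H: "verts H = {0..<k}"
  shows "decidable N (\<lambda>(G :: 'a graph) e.
    \<exists>f. embeds H (subgraph_complement G (typed_verts N T G e)) f)"
proof -
  define Q :: "'a graph \<Rightarrow> (nat \<Rightarrow> 'a) \<Rightarrow> bool" where
    "Q G e \<longleftrightarrow> (\<forall>p\<in>{0..<k} \<times> {0..<k}. (e (N + fst p) = e (N + snd p) \<longleftrightarrow> fst p = snd p) \<and>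
       ({e (N + fst p), e (N + snd p)} \<in> edges (subgraph_complement G (typed_verts N T G e)) \<longleftrightarrow>
         {fst p, snd p} \<in> edges H))" for G e
  have "decidable (N + k) Q"
    unfolding Q_def
    by (intro decidable_ball_finite decidable_conj decidable_iff decidable_const decidable_eq
        decidable_complement_edge) auto
  note dec = decidable_ex_many[OF this]
  show ?thesis
  proof (rule decidable_cong[OF dec])
    fix G and e :: "nat \<Rightarrow> 'a"
    let ?G = "subgraph_complement G (typed_verts N T G e)"
    have V: "verts ?G = verts G"
      by (simp add: subgraph_complement_def)
    \<comment> \<open>Types read only the positions below \<open>N\<close>, so choosing the copy of
      \<open>H\<close> does not change the complemented set.\<close>
    have typed: "typed_verts N T G (override_on e f {N..<N + k}) = typed_verts N T G e" for f
    proof -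
      have "vertex_type N G (override_on e f {N..<N + k}) v = vertex_type N G e v" for v
        unfolding vertex_type_def by (rule map_cong) (auto simp: override_on_def)
      then show ?thesis
        by (simp add: typed_verts_def)
    qed
    have Q: "(\<forall>i\<in>{N..<N + k}. f i \<in> verts G) \<and> Q G (override_on e f {N..<N + k}) \<longleftrightarrow>
        embeds H ?G (\<lambda>i. f (N + i))" for f
    proof -
      have val: "override_on e f {N..<N + k} (N + i) = f (N + i)" if "i < k" for i
        using that by simp
      have "(\<forall>i\<in>{N..<N + k}. f i \<in> verts G) \<longleftrightarrow> (\<lambda>i. f (N + i)) ` {0..<k} \<subseteq> verts G"
      proof -
        have "{N..<N + k} = (+) N ` {0..<k}"
          by (simp add: add.commute)
        then show ?thesis
          by (simp only: image_subset_iff ball_simps)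
      qed
      moreover have "Q G (override_on e f {N..<N + k}) \<longleftrightarrow>
          (\<forall>i\<in>{0..<k}. \<forall>j\<in>{0..<k}. (f (N + i) = f (N + j) \<longleftrightarrow> i = j) \<and>
            ({f (N + i), f (N + j)} \<in> edges ?G \<longleftrightarrow> {i, j} \<in> edges H))"
        unfolding Q_def typed by (simp add: Ball_def val) blast
      ultimately show ?thesis
        unfolding embeds_def H V inj_on_def by blast
    qed
    show "(\<exists>f. (\<forall>i\<in>{N..<N + k}. f i \<in> verts G) \<and> Q G (override_on e f {N..<N + k})) \<longleftrightarrow>
        (\<exists>f. embeds H ?G f)"
    proof
      assume "\<exists>f. embeds H ?G f"
      then obtain f where "embeds H ?G f" ..
      then show "\<exists>f. (\<forall>i\<in>{N..<N + k}. f i \<in> verts G) \<and> Q G (override_on e f {N..<N + k})"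
        unfolding Q by (intro exI[of _ "\<lambda>j. f (j - N)"]) simp
    qed (auto simp only: Q)
  qed
qed

lemma decidable_solution:
  "decidable 0 (\<lambda>(G :: 'a graph) e. \<exists>T\<in>Pow {bs. length bs = 2 * N}.
     \<exists>f. (\<forall>i\<in>{0..<N}. f i \<in> verts G) \<and>
       subgraph_complement G (typed_verts N T G (override_on e f {0..<N})) \<in> free_graphs {star t, diamond})"
proof (rule decidable_bex_finite)
  fix T
  have star: "verts (star t) = {0..<Suc t}" and diamond: "verts diamond = {0..<4}"
    by (auto simp: star_def diamond_def)
  have "decidable N (\<lambda>(G :: 'a graph) e.
      \<not> (\<exists>f. embeds (star t) (subgraph_complement G (typed_verts N T G e)) f) \<and>
      \<not> (\<exists>f. embeds diamond (subgraph_complement G (typed_verts N T G e)) f))"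
    by (intro decidable_conj decidable_not decidable_embeds[OF star] decidable_embeds[OF diamond])
  then have "decidable (0 + N) (\<lambda>(G :: 'a graph) e.
      subgraph_complement G (typed_verts N T G e) \<in> free_graphs {star t, diamond})"
    by (auto elim!: decidable_cong
        simp: in_free_graphs_iff finite_simple_graph_subgraph_complement)
  from decidable_ex_many[OF this]
  show "decidable 0 (\<lambda>(G :: 'a graph) e. \<exists>f. (\<forall>i\<in>{0..<N}. f i \<in> verts G) \<and>
      subgraph_complement G (typed_verts N T G (override_on e f {0..<N})) \<in> free_graphs {star t, diamond})"
    by simp
qed (simp add: finite_bool_lists)

text \<open>Take the vertices of a separating set as parameters and the types of the solution as
  \<open>T\<close>. Distinct vertices of equal type are not parameters and have the same adjacencies
  to them, so a separated solution is a union of types.\<close>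

lemma solution_iff_typed_solution:
  fixes G :: "'a graph"
  assumes G: "finite_simple_graph G" "verts G \<noteq> {}" and t: "t \<ge> 1"
  shows "G \<in> subgraph_complementation_to (free_graphs {star t, diamond}) \<longleftrightarrow>
    (\<exists>T\<in>Pow {bs. length bs = 2 * (5 * t + 2)}.
     \<exists>f. (\<forall>i\<in>{0..<5 * t + 2}. f i \<in> verts G) \<and>
       subgraph_complement G (typed_verts (5 * t + 2) T G (override_on e f {0..<5 * t + 2}))
         \<in> free_graphs {star t, diamond})"
    (is "_ \<longleftrightarrow> ?typed")
proof
  assume ?typed
  then obtain T f where
    "subgraph_complement G (typed_verts (5 * t + 2) T G (override_on e f {0..<5 * t + 2}))
      \<in> free_graphs {star t, diamond}"
    by blast
  moreover have "typed_verts (5 * t + 2) T G (override_on e f {0..<5 * t + 2}) \<subseteq> verts G"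
    by (auto simp: typed_verts_def)
  ultimately show "G \<in> subgraph_complementation_to (free_graphs {star t, diamond})"
    using G(1) unfolding subgraph_complementation_to_def by blast
next
  define N where "N = 5 * t + 2"
  assume "G \<in> subgraph_complementation_to (free_graphs {star t, diamond})"
  then obtain S0 where "S0 \<subseteq> verts G" "subgraph_complement G S0 \<in> free_graphs {star t, diamond}"
    unfolding subgraph_complementation_to_def by blast
  from ex_separated_solution[OF G(1) t this] obtain S P where
    S: "S \<subseteq> verts G" "subgraph_complement G S \<in> free_graphs {star t, diamond}"
    and P: "P \<subseteq> verts G" "card P \<le> N"
    and sep: "\<And>u v. u \<in> S - P \<Longrightarrow> v \<in> verts G - S - P \<Longrightarrow>
       \<exists>p\<in>P. ({u, p} \<in> edges G) \<noteq> ({v, p} \<in> edges G)"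
    unfolding N_def by blast
  obtain w where w: "w \<in> verts G"
    using G(2) by blast
  have "finite P"
    using P(1) G(1) finite_subset unfolding finite_simple_graph_def by blast
  then obtain ps where ps: "set ps = P" "length ps \<le> N"
    using P(2) by (metis finite_distinct_list distinct_card)
  \<comment> \<open>A separating set with fewer than \<open>N\<close> vertices is padded by an
    arbitrary vertex \<open>w\<close>; this is where the graph has to be nonempty.\<close>
  define f where "f i = (if i < length ps then ps ! i else w)" for i
  define f' where "f' = override_on e f {0..<N}"
  have f: "\<forall>i\<in>{0..<N}. f i \<in> verts G"
    using ps P(1) w by (auto simp: f_def)
  have Pf: "\<exists>i<N. p = f' i" if p: "p \<in> P" for p
  proof -
    obtain i where "i < length ps" "p = ps ! i"
      using p ps(1) by (metis in_set_conv_nth)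
    then show ?thesis
      using ps(2) by (intro exI[of _ i]) (auto simp: f'_def f_def)
  qed
  define T where "T = vertex_type N G f' ` S"
  have eq_iff: "u = f' i \<longleftrightarrow> v = f' i" "{u, f' i} \<in> edges G \<longleftrightarrow> {v, f' i} \<in> edges G"
    if same: "vertex_type N G f' u = vertex_type N G f' v" and i: "i < N" for u v i
  proof -
    have "vertex_type N G f' u ! i = vertex_type N G f' v ! i"
      "vertex_type N G f' u ! (i + N) = vertex_type N G f' v ! (i + N)"
      using same by simp_all
    then show "u = f' i \<longleftrightarrow> v = f' i" "{u, f' i} \<in> edges G \<longleftrightarrow> {v, f' i} \<in> edges G"
      using i by (simp_all add: vertex_type_def)
  qed
  \<comment> \<open>A parameter shares its type with no other vertex, so \<open>u\<close> and
    \<open>v\<close> lie outside \<open>P\<close> and separation applies.\<close>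
  have "v \<in> S" if u: "u \<in> S" and v: "v \<in> verts G"
    and same: "vertex_type N G f' u = vertex_type N G f' v" for u v
  proof (rule ccontr)
    assume "v \<notin> S"
    have "u \<notin> P" "v \<notin> P"
      using Pf eq_iff(1)[OF same] u \<open>v \<notin> S\<close> by blast+
    then obtain p where "p \<in> P" "({u, p} \<in> edges G) \<noteq> ({v, p} \<in> edges G)"
      using sep u v \<open>v \<notin> S\<close> by blast
    then show False
      using Pf eq_iff(2)[OF same] by blast
  qed
  then have "typed_verts N T G f' = S"
    using S(1) unfolding typed_verts_def T_def by auto
  moreover have "T \<subseteq> {bs. length bs = 2 * N}"
    by (auto simp: T_def vertex_type_def)
  ultimately show ?typed
    using S(2) f unfolding N_def[symmetric] f'_def by blast
qed

section \<open>Reading the adjacency matrix\<close>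

lemma length_row_major:
  "length (concat (map (\<lambda>u. map (g u) vs) us)) = length us * length vs"
  by (induction us) auto

text \<open>Rows \<open>us\<close> and columns \<open>vs\<close> are separate lists so that the
  induction removes rows only.\<close>

lemma nth_row_major:
  assumes "i < length us" "j < length vs"
  shows "concat (map (\<lambda>u. map (g u) vs) us) ! (i * length vs + j) = g (us ! i) (vs ! j)"
  using assms
proof (induction us arbitrary: i)
  case (Cons u us)
  then show ?case
    by (cases i) (auto simp: nth_append)
qed simp

text \<open>
  The number \<open>n\<close> of vertices is recovered from the input length \<open>n\<^sup>2\<close> by summing odd numbers. The
  empty graph is treated separately because the other code assumes that all variables denote vertices.
\<close>

lemma polynomial_time_solvable_if_decidable:
  fixes Q :: "'a graph \<Rightarrow> (nat \<Rightarrow> 'a) \<Rightarrow> bool"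
  assumes dec: "decidable 0 Q"
    and Q: "\<And>G e. finite_simple_graph G \<Longrightarrow> verts G \<noteq> {} \<Longrightarrow> Q G e \<longleftrightarrow> G \<in> Y"
    and empty: "\<And>G. finite_simple_graph G \<Longrightarrow> verts G = {} \<Longrightarrow> G \<in> Y"
  shows "polynomial_time_solvable graph_encodings {G :: 'a graph. finite_simple_graph G} Y"
proof -
  obtain c l p where c: "evaluates c l p 0 Q"
    using dec unfolding decidable_def by blast
  \<comment> \<open>Addresses 2 to 8 raise register 1 and keep its square in register 4 until the
    square reaches the input length; \<open>c\<close> starts at 9. Input length 0 leads to the last
    instruction, which answers yes for the empty graph.\<close>
  define P where "P = [Const 2 1, JumpZero 0 (10 + l), Add 4 4 1, Add 4 4 1, Add 4 4 2, Add 1 1 2,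
    Sub 5 0 4, JumpZero 5 9, JumpZero 3 2] @ c 9 @ [JumpZero 3 (11 + l), Const 0 1]"
  have lenP: "length P = 11 + l"
    by (simp add: P_def evaluates_length[OF c])
  have "code_at P 0 ([Const 2 1, JumpZero 0 (10 + l), Add 4 4 1, Add 4 4 1, Add 4 4 2, Add 1 1 2,
      Sub 5 0 4, JumpZero 5 9, JumpZero 3 2] @ c 9 @ [JumpZero 3 (11 + l), Const 0 1])"
    using code_at_self[of P] unfolding P_def .
  then have code: "code_at P 9 (c 9)"
    and instrs: "P ! 0 = Const 2 1" "P ! 1 = JumpZero 0 (10 + l)" "P ! 2 = Add 4 4 1"
      "P ! 3 = Add 4 4 1" "P ! 4 = Add 4 4 2" "P ! 5 = Add 1 1 2" "P ! 6 = Sub 5 0 4"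
      "P ! 7 = JumpZero 5 9" "P ! 8 = JumpZero 3 2" "P ! (9 + l) = JumpZero 3 (11 + l)"
      "P ! (10 + l) = Const 0 1"
    by (simp_all add: evaluates_length[OF c] numeral_eq_Suc)
  \<comment> \<open>The first factor bounds the number of instructions; the second is the price
    \<open>B\<close>, written as a polynomial in the input length \<open>n * n\<close>.\<close>
  define q where "q = ([:4, 7:] + p) * [:2, 2:]"
  show ?thesis
    unfolding polynomial_time_solvable_def
  proof (intro exI[of _ P] exI[of _ q] ballI)
    fix G :: "'a graph" and w
    assume G: "G \<in> {G. finite_simple_graph G}" and "w \<in> graph_encodings G"
    then obtain vs where w: "w = adjacency_matrix G vs" and vs: "distinct vs" "set vs = verts G"
      unfolding graph_encodings_def by blast
    define n where "n = length vs"
    define B where "B = 2 * (n * n) + 2"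
    have lenw: "length w = n * n"
      by (simp add: w adjacency_matrix_def length_row_major n_def)
    define M :: "nat \<Rightarrow> nat" where "M i = (if i < length w then of_bool (w ! i) else 0)" for i
    have init: "initial_config w = (0, (\<lambda>_. 0)(0 := n * n), M)"
      by (simp add: initial_config_def M_def[abs_def] lenw)
    \<comment> \<open>Registers of the loop after \<open>m\<close> increments: the square in
      register 4, the last difference \<open>y\<close> in register 5. Register 3 stays 0.\<close>
    define st where "st m y = (\<lambda>_ :: nat. 0 :: nat)(0 := n * n, 1 := m, 2 := 1, 4 := m * m, 5 := y)" for m y
    have bit: "bit_length 0 \<le> B" "bit_length 1 \<le> B" "bit_length (n * n) \<le> B"
      using bit_length_le[of "n * n"] by (simp_all add: B_def bit_length_def)
    have first: "reaches P B 1 (0, (\<lambda>_. 0)(0 := n * n), M) (1, st 0 0, M)"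
      using instrs(1) lenP bit by (intro reaches_instr) (auto simp: st_def fun_eq_iff)
    have "\<exists>R pc. reaches P B (poly ([:4, 7:] + p) (n * n)) (initial_config w) (pc, R, M) \<and>
        length P \<le> pc \<and> R 0 = of_bool (G \<in> Y)"
    proof (cases "n = 0")
      case True
      then have "verts G = {}"
        using vs n_def by auto
      then have Y: "G \<in> Y"
        using empty G by blast
      have "reaches P B 1 (1, st 0 0, M) (10 + l, st 0 0, M)"
        using instrs(2) lenP bit True by (intro reaches_instr) (auto simp: st_def)
      moreover have "reaches P B 1 (10 + l, st 0 0, M) (11 + l, (st 0 0)(0 := 1), M)"
        using instrs(11) lenP bit by (intro reaches_instr) auto
      ultimately have "reaches P B (1 + (1 + 1)) (initial_config w) (11 + l, (st 0 0)(0 := 1), M)"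
        unfolding init using first by (blast intro: reaches_trans)
      then have "reaches P B (poly ([:4, 7:] + p) (n * n)) (initial_config w)
          (11 + l, (st 0 0)(0 := 1), M)"
        by (rule reaches_mono) simp
      then show ?thesis
        using lenP Y by (intro exI[of _ "(st 0 0)(0 := 1)"] exI[of _ "11 + l"]) simp
    next
      case False
      then have n: "0 < n" "1 \<le> n * n" "n \<le> n * n"
        by (auto simp: Suc_le_eq)
      \<comment> \<open>\<open>k\<close> is the number of rounds left, at most seven instructions
        each; \<open>y\<close> is arbitrary because register 5 is overwritten before it is
        read.\<close>
      have loop: "reaches P B (7 * k) (2, st (n - k) y, M) (9, st n 0, M)" if "0 < k" "k \<le> n" for k y
        using that
      proof (induction k arbitrary: y)
        case (Suc k)
        define m where "m = n - Suc k"
        define z where "z = n * n - Suc m * Suc m"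
        have m: "m < n" "n - k = Suc m" "n - Suc k = m"
          using Suc.prems by (auto simp: m_def)
        have sq: "Suc m * Suc m \<le> n * n"
          using m(1) by (intro mult_le_mono) auto
        have z0: "z = 0 \<longleftrightarrow> k = 0"
        proof -
          have "Suc m * Suc m < n * n" if "k \<noteq> 0"
            using that m by (intro mult_strict_mono) linarith+
          moreover have "Suc m = n" if "k = 0"
            using that m by linarith
          ultimately show ?thesis
            unfolding z_def using sq by (metis diff_is_0_eq diff_self_eq_0 leD)
        qed
        have sq': "m * m + m + m + 1 = Suc m * Suc m"
          by simp
        have "m * m + m + m + 1 \<le> n * n"
          using sq sq' by simp
        then have le: "m \<le> n * n" "m * m \<le> n * n" "m * m + m \<le> n * n" "m * m + m + m \<le> n * n"
          by linarith+
        have "reaches P B 1 (2, st m y, M) (3, (st m y)(4 := m * m + m), M)"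
          using instrs(3) lenP bit_lengths_le_bound[OF le(2,1)]
          by (intro reaches_instr) (auto simp: st_def B_def)
        moreover have "reaches P B 1 (3, (st m y)(4 := m * m + m), M)
            (4, (st m y)(4 := m * m + m + m), M)"
          using instrs(4) lenP bit_lengths_le_bound[OF le(3,1)]
          by (intro reaches_instr) (auto simp: st_def B_def)
        moreover have "reaches P B 1 (4, (st m y)(4 := m * m + m + m), M)
            (5, (st m y)(4 := m * m + m + m + 1), M)"
          using instrs(5) lenP bit_lengths_le_bound[OF le(4) n(2)]
          by (intro reaches_instr) (auto simp: st_def B_def)
        moreover have "reaches P B 1 (5, (st m y)(4 := m * m + m + m + 1), M) (6, st (Suc m) y, M)"
          using instrs(6) lenP bit_lengths_le_bound[OF le(1) n(2)]
          by (intro reaches_instr) (auto simp: st_def B_def fun_eq_iff)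
        moreover have "reaches P B 1 (6, st (Suc m) y, M) (7, st (Suc m) z, M)"
          using instrs(7) lenP bit_lengths_le_bound[OF order_refl sq]
          by (intro reaches_instr) (simp_all add: st_def B_def z_def)
        moreover have "reaches P B 1 (7, st (Suc m) z, M) (if k = 0 then 9 else 8, st (Suc m) z, M)"
          using instrs(8) lenP bit_length_le_bound[of z "n * n"] z0
          by (intro reaches_instr) (auto simp: st_def B_def z_def)
        ultimately have "reaches P B (1 + 1 + 1 + 1 + 1 + 1) (2, st m y, M)
            (if k = 0 then 9 else 8, st (Suc m) z, M)"
          by (intro reaches_trans)
        then have body: "reaches P B 6 (2, st m y, M) (if k = 0 then 9 else 8, st (Suc m) z, M)"
          by (rule reaches_mono) simp
        show ?case
        proof (cases "k = 0")
          case True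
          then have "Suc m = n" "z = 0"
            using m z0 by auto
          then show ?thesis
            using body True m by (auto elim!: reaches_mono)
        next
          case k: False
          have "reaches P B 1 (8, st (Suc m) z, M) (2, st (Suc m) z, M)"
            using instrs(9) lenP bit by (intro reaches_instr) (auto simp: st_def)
          moreover have "reaches P B (7 * k) (2, st (Suc m) z, M) (9, st n 0, M)"
            using Suc.IH[of z] Suc.prems k m by simp
          moreover have "reaches P B 6 (2, st m y, M) (8, st (Suc m) z, M)"
            using body k by simp
          ultimately have "reaches P B (6 + (1 + 7 * k)) (2, st m y, M) (9, st n 0, M)"
            by (blast intro: reaches_trans)
          then show ?thesis
            unfolding m(3) by (rule reaches_mono) simp
        qed
      qed simp
      have enter: "reaches P B 1 (1, st 0 0, M) (2, st 0 0, M)"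
        using instrs(2) lenP bit n by (intro reaches_instr) (auto simp: st_def)
      have loop: "reaches P B (7 * n) (2, st 0 0, M) (9, st n 0, M)"
        using loop[of n 0] n by simp
      have "matrix_memory G vs M"
        unfolding matrix_memory_def
      proof (intro conjI allI impI)
        fix i j assume ij: "i < length vs" "j < length vs"
        have "i * n + j < Suc i * n"
          using ij by (simp add: n_def)
        also have "\<dots> \<le> n * n"
          using ij by (intro mult_le_mono1) (simp add: n_def)
        finally show "M (i * length vs + j) = of_bool ({vs ! i, vs ! j} \<in> edges G)"
          using nth_row_major[OF ij, of "\<lambda>u v. {u, v} \<in> edges G"]
          by (simp add: M_def lenw) (simp add: w adjacency_matrix_def n_def)
      qed (use G vs in auto)
      moreover have "reg_inv n (st n 0)"
        using n by (auto simp: reg_inv_def st_def)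
      moreover have "env_inv 0 vs (st n 0) undefined"
        by (simp add: env_inv_def)
      ultimately obtain R where R: "reaches P B (poly p (n * n)) (9, st n 0, M) (9 + l, R, M)"
        "reg_inv n R" "R 0 = of_bool (Q G undefined)"
        using evaluatesD[OF c code _ _ _ n_def B_def] by metis
      have "verts G \<noteq> {}"
        using vs(2) n(1) n_def by force
      then have R0: "R 0 = of_bool (G \<in> Y)"
        using R(3) Q G by simp
      have "reaches P B 1 (9 + l, R, M) (11 + l, R, M)"
        using instrs(10) lenP bit R(2) by (intro reaches_instr) (auto simp: reg_inv_def)
      then have "reaches P B (1 + (1 + (7 * n + (poly p (n * n) + 1)))) (initial_config w) (11 + l, R, M)"
        unfolding init using first enter loop R(1) by (blast intro: reaches_trans)
      moreover have "poly ([:4, 7:] + p) (n * n) = 4 + 7 * (n * n) + poly p (n * n)"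
        by simp
      then have "1 + (1 + (7 * n + (poly p (n * n) + 1))) \<le> poly ([:4, 7:] + p) (n * n)"
        using n(3) by linarith
      ultimately have "reaches P B (poly ([:4, 7:] + p) (n * n)) (initial_config w) (11 + l, R, M)"
        by (rule reaches_mono)
      then show ?thesis
        using R0 lenP by (intro exI[of _ R] exI[of _ "11 + l"]) simp
    qed
    then obtain R pc k where "k \<le> poly ([:4, 7:] + p) (n * n) * B"
      "runs P (initial_config w) k (pc, R, M)" "length P \<le> pc" "R 0 = of_bool (G \<in> Y)"
      unfolding reaches_def by blast
    moreover have "poly ([:4, 7:] + p) (n * n) * B = poly q (length w)"
      unfolding q_def poly_mult lenw B_def by simp
    ultimately show "\<exists>k\<le>poly q (length w). answers P w k (G \<in> Y)"
      unfolding answers_def by metis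
  qed
qed

theorem theorem1:
  fixes t :: nat
  assumes "t \<ge> 3"
  shows "polynomial_time_solvable graph_encodings
           {G :: nat graph. finite_simple_graph G}
           (subgraph_complementation_to (free_graphs {star t, diamond}))"
proof (rule polynomial_time_solvable_if_decidable[OF decidable_solution[of "5 * t + 2" t]])
  fix G :: "nat graph" and e
  assume G: "finite_simple_graph G"
  have t: "t \<ge> 1"
    using assms by simp
  show "G \<in> subgraph_complementation_to (free_graphs {star t, diamond})" if "verts G = {}"
  proof -
    have "edges (subgraph_complement G {}) = {}"
      using that by (auto simp: subgraph_complement_def)
    then have "subgraph_complement G {} \<in> free_graphs {star t, diamond}"
      unfolding in_free_star_diamond_iff[OF finite_simple_graph_subgraph_complement[OF G] t]
        star_free_adj_def diamond_free_adj_def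
      using t by (metis card.empty empty_iff equals0I not_one_le_zero)
    then show ?thesis
      using G unfolding subgraph_complementation_to_def by blast
  qed
  show "(\<exists>T\<in>Pow {bs. length bs = 2 * (5 * t + 2)}.
     \<exists>f. (\<forall>i\<in>{0..<5 * t + 2}. f i \<in> verts G) \<and>
       subgraph_complement G (typed_verts (5 * t + 2) T G (override_on e f {0..<5 * t + 2}))
         \<in> free_graphs {star t, diamond}) \<longleftrightarrow>
    G \<in> subgraph_complementation_to (free_graphs {star t, diamond})" if "verts G \<noteq> {}"
    using solution_iff_typed_solution[OF G that t, of e] by blast
qed

end
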